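(* Let $L/K$ be unramified, ramified or split, with $\mathcal{T}$, basin $\mathcal{P}$ and layers $\mathcal{R}_n$ as in the context, and let $n\ge0$. A vertex $v$ of $\mathcal{T}$ is the homothety class of some principal ideal of $\mathcal{O}_n$ of rank $2$ over $\mathcal{O}_K$ if and only if $v\in\mathcal{R}_n$.
   Context: $K$ is a nonarchimedean local field of characteristic zero with ring of integers $\mathcal{O}_K$, uniformizer $p$, residue field of cardinality $q$. $L$ is a reduced $K$-algebra of dimension $2$: an unramified quadratic field extension, a ramified quadratic field extension, or $K\times K$ (split). $\mathcal{O}_L$ is the integral closure of $\mathcal{O}_K$ in $L$; fix $\Delta$ with $\mathcal{O}_L=\mathcal{O}_K[\Delta]$ and set $\mathcal{O}_n=\mathcal{O}_K[p^n\Delta]$ for $n\ge0$. $\mathcal{T}$ is the Bruhat–Tits tree of $SL(2,K)$ on $L$: vertices are homothety classes $[\Lambda]$ (under $K^*$) of rank-2 free $\mathcal{O}_K$-submodules $\Lambda$ of $L$, adjacent iff representatives satisfy $p\Lambda\subsetneq\Lambda'\subsetneq\Lambda$. The basin $\mathcal{P}$ is $\{[\mathcal{O}_L]\}$ (unramified), the edge $\{[\mathcal{O}_L],[\pi\mathcal{O}_L]\}$ with $\pi$ a uniformizer of $L$ (ramified), or the apartment $\{[\mathcal{O}_K\times p^m\mathcal{O}_K]: m\in\mathbb{Z}\}$ (split). $\mathcal{P}_0=\mathcal{P}$, $\mathcal{P}_n=\{v: d(v,\mathcal{P}_{n-1})\le 1\}$, $\mathcal{R}_0=\mathcal{P}$,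 $\mathcal{R}_n=\mathcal{P}_n\setminus\mathcal{P}_{n-1}$. *)

theory Defs
  imports Complex_Main "HOL-Library.Extended_Nat" "HOL-Computational_Algebra.Polynomial"
begin

text \<open>
  The valuation is integer-valued and only meaningful on nonzero elements, so
  \<open>val_ge val k\<close> describes the fractional ideal of elements of valuation at least \<open>k\<close>.
\<close>

definition val_ge :: "('k::field \<Rightarrow> int) \<Rightarrow> int \<Rightarrow> 'k set" where
  "val_ge val k = {x. x = 0 \<or> k \<le> val x}"

abbreviation val_ring :: "('k::field \<Rightarrow> int) \<Rightarrow> 'k set" where
  "val_ring val \<equiv> val_ge val 0"

text \<open>
  A nonarchimedean local field of characteristic zero: a field that is complete for a
  normalized discrete valuation and has finite residue field (the cosets of the maximal ideal
  in the valuation ring).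
\<close>

locale local_field_char_0 =
  fixes val :: "'k::field_char_0 \<Rightarrow> int"
  assumes val_mult: "x \<noteq> 0 \<Longrightarrow> y \<noteq> 0 \<Longrightarrow> val (x * y) = val x + val y"
    and val_add: "x \<noteq> 0 \<Longrightarrow> y \<noteq> 0 \<Longrightarrow> x + y \<noteq> 0 \<Longrightarrow> min (val x) (val y) \<le> val (x + y)"
    and val_normalized: "\<exists>x. x \<noteq> 0 \<and> val x = 1"
    and val_complete:
      "\<And>X :: nat \<Rightarrow> 'k. (\<forall>k. \<exists>M. \<forall>i\<ge>M. \<forall>j\<ge>M. X i - X j \<in> val_ge val k) \<Longrightarrow>
        \<exists>l. \<forall>k. \<exists>M. \<forall>i\<ge>M. X i - l \<in> val_ge val k"
    and finite_residue_field: "finite {{y. y - x \<in> val_ge val 1} |x. x \<in> val_ring val}"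

text \<open>\<open>\<O>\<^sub>K[a]\<close> as a subring of \<open>L\<close>, where \<open>\<iota>\<close> is the structure map \<open>K \<rightarrow> L\<close>.\<close>

definition adjoin :: "('k::field \<Rightarrow> int) \<Rightarrow> ('k \<Rightarrow> 'l::comm_ring_1) \<Rightarrow> 'l \<Rightarrow> 'l set" where
  "adjoin val \<iota> a = {poly (map_poly \<iota> f) a |f. \<forall>i. coeff f i \<in> val_ring val}"

definition integral_closure :: "('k::field \<Rightarrow> int) \<Rightarrow> ('k \<Rightarrow> 'l::comm_ring_1) \<Rightarrow> 'l set" where
  "integral_closure val \<iota> =
    {x. \<exists>f. lead_coeff f = 1 \<and> (\<forall>i. coeff f i \<in> val_ring val) \<and> poly (map_poly \<iota> f) x = 0}"

locale quadratic_algebra = local_field_char_0 val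
  for val :: "'k::field_char_0 \<Rightarrow> int" +
  fixes p :: 'k and \<iota> :: "'k \<Rightarrow> 'l::comm_ring_1" and \<Delta> :: 'l
  assumes uniformizer_K: "p \<noteq> 0" "val p = 1"
    and \<iota>_one: "\<iota> 1 = 1"
    and \<iota>_add: "\<iota> (a + b) = \<iota> a + \<iota> b"
    and \<iota>_mult: "\<iota> (a * b) = \<iota> a * \<iota> b"
    and dim_2: "vector_space.dim (\<lambda>a x. \<iota> a * x) (UNIV :: 'l set) = 2"
    and reduced: "x ^ m = 0 \<Longrightarrow> x = (0::'l)"
    and generator: "integral_closure val \<iota> = adjoin val \<iota> \<Delta>"

definition quadratic_order ::
    "('k::field \<Rightarrow> int) \<Rightarrow> 'k \<Rightarrow> ('k \<Rightarrow> 'l::comm_ring_1) \<Rightarrow> 'l \<Rightarrow> nat \<Rightarrow> 'l set" where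
  "quadratic_order val p \<iota> \<Delta> n = adjoin val \<iota> (\<iota> (p ^ n) * \<Delta>)"

definition principal_ideal_of :: "'l::comm_ring_1 set \<Rightarrow> 'l set \<Rightarrow> bool" where
  "principal_ideal_of R I \<longleftrightarrow> (\<exists>a\<in>R. I = (\<lambda>x. a * x) ` R)"

text \<open>Free \<open>\<O>\<^sub>K\<close>-submodules of rank 2, i.e. those possessing an \<open>\<O>\<^sub>K\<close>-basis of two elements.\<close>

definition free_rank_2 :: "('k::field \<Rightarrow> int) \<Rightarrow> ('k \<Rightarrow> 'l::comm_ring_1) \<Rightarrow> 'l set \<Rightarrow> bool" where
  "free_rank_2 val \<iota> \<Lambda> \<longleftrightarrow> (\<exists>b c.
     \<Lambda> = {\<iota> r * b + \<iota> s * c |r s. r \<in> val_ring val \<and> s \<in> val_ring val} \<and>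
     (\<forall>r\<in>val_ring val. \<forall>s\<in>val_ring val. \<iota> r * b + \<iota> s * c = 0 \<longrightarrow> r = 0 \<and> s = 0))"

definition homothety_class :: "('k::field \<Rightarrow> 'l::comm_ring_1) \<Rightarrow> 'l set \<Rightarrow> 'l set set" where
  "homothety_class \<iota> \<Lambda> = {(\<lambda>x. \<iota> a * x) ` \<Lambda> |a. a \<noteq> 0}"

definition tree_vertices :: "('k::field \<Rightarrow> int) \<Rightarrow> ('k \<Rightarrow> 'l::comm_ring_1) \<Rightarrow> 'l set set set" where
  "tree_vertices val \<iota> = {homothety_class \<iota> \<Lambda> |\<Lambda>. free_rank_2 val \<iota> \<Lambda>}"

definition tree_adj ::
    "('k::field \<Rightarrow> int) \<Rightarrow> 'k \<Rightarrow> ('k \<Rightarrow> 'l::comm_ring_1) \<Rightarrow> 'l set set \<Rightarrow> 'l set set \<Rightarrow> bool" where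
  "tree_adj val p \<iota> v w \<longleftrightarrow> v \<in> tree_vertices val \<iota> \<and> w \<in> tree_vertices val \<iota> \<and>
     (\<exists>\<Lambda>\<in>v. \<exists>\<Lambda>'\<in>w. (\<lambda>x. \<iota> p * x) ` \<Lambda> \<subset> \<Lambda>' \<and> \<Lambda>' \<subset> \<Lambda>)"

definition tree_dist ::
    "('k::field \<Rightarrow> int) \<Rightarrow> 'k \<Rightarrow> ('k \<Rightarrow> 'l::comm_ring_1) \<Rightarrow> 'l set set \<Rightarrow> 'l set set \<Rightarrow> enat" where
  "tree_dist val p \<iota> v w = (INF k \<in> {k. (tree_adj val p \<iota> ^^ k) v w}. enat k)"

definition tree_setdist ::
    "('k::field \<Rightarrow> int) \<Rightarrow> 'k \<Rightarrow> ('k \<Rightarrow> 'l::comm_ring_1) \<Rightarrow> 'l set set \<Rightarrow> 'l set set set \<Rightarrow> enat" where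
  "tree_setdist val p \<iota> v S = (INF w\<in>S. tree_dist val p \<iota> v w)"

definition is_field_type :: "'l::comm_ring_1 itself \<Rightarrow> bool" where
  "is_field_type _ \<longleftrightarrow> (\<forall>x::'l. x \<noteq> 0 \<longrightarrow> (\<exists>y. x * y = 1))"

text \<open>
  When \<open>L\<close> is a field, \<open>\<O>\<^sub>L\<close> is a local ring, so its maximal ideal is the set of nonunits;
  a uniformizer is a generator of it.
\<close>

definition uniformizer_L :: "('k::field \<Rightarrow> int) \<Rightarrow> ('k \<Rightarrow> 'l::comm_ring_1) \<Rightarrow> 'l \<Rightarrow> bool" where
  "uniformizer_L val \<iota> \<pi> \<longleftrightarrow>
     {x \<in> integral_closure val \<iota>. \<not> (\<exists>y\<in>integral_closure val \<iota>. x * y = 1)} =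
     (\<lambda>x. \<pi> * x) ` integral_closure val \<iota>"

definition has_ramification_index ::
    "('k::field \<Rightarrow> int) \<Rightarrow> 'k \<Rightarrow> ('k \<Rightarrow> 'l::comm_ring_1) \<Rightarrow> nat \<Rightarrow> bool" where
  "has_ramification_index val p \<iota> e \<longleftrightarrow> (\<exists>\<pi>. uniformizer_L val \<iota> \<pi> \<and>
     (\<lambda>x. \<iota> p * x) ` integral_closure val \<iota> = (\<lambda>x. \<pi> ^ e * x) ` integral_closure val \<iota>)"

text \<open>Separability of the residue extension is automatic, residue fields being finite.\<close>

definition unramified_ext :: "('k::field \<Rightarrow> int) \<Rightarrow> 'k \<Rightarrow> ('k \<Rightarrow> 'l::comm_ring_1) \<Rightarrow> bool" where
  "unramified_ext val p \<iota> \<longleftrightarrow> is_field_type TYPE('l) \<and> has_ramification_index val p \<iota> 1"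

definition ramified_ext :: "('k::field \<Rightarrow> int) \<Rightarrow> 'k \<Rightarrow> ('k \<Rightarrow> 'l::comm_ring_1) \<Rightarrow> bool" where
  "ramified_ext val p \<iota> \<longleftrightarrow>
     is_field_type TYPE('l) \<and> (\<exists>e>1. has_ramification_index val p \<iota> e)"

text \<open>\<open>\<phi>\<close> is an isomorphism of \<open>K\<close>-algebras from \<open>L\<close> to \<open>K \<times> K\<close>.\<close>

definition splitting_iso :: "('k::field \<Rightarrow> 'l::comm_ring_1) \<Rightarrow> ('l \<Rightarrow> 'k \<times> 'k) \<Rightarrow> bool" where
  "splitting_iso \<iota> \<phi> \<longleftrightarrow> bij \<phi> \<and>
     (\<forall>x y. \<phi> (x + y) = (fst (\<phi> x) + fst (\<phi> y), snd (\<phi> x) + snd (\<phi> y))) \<and>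
     (\<forall>x y. \<phi> (x * y) = (fst (\<phi> x) * fst (\<phi> y), snd (\<phi> x) * snd (\<phi> y))) \<and>
     (\<forall>a. \<phi> (\<iota> a) = (a, a))"

definition is_basin ::
    "('k::field \<Rightarrow> int) \<Rightarrow> 'k \<Rightarrow> ('k \<Rightarrow> 'l::comm_ring_1) \<Rightarrow> 'l set set set \<Rightarrow> bool" where
  "is_basin val p \<iota> P \<longleftrightarrow>
     (unramified_ext val p \<iota> \<and> P = {homothety_class \<iota> (integral_closure val \<iota>)}) \<or>
     (ramified_ext val p \<iota> \<and> (\<exists>\<pi>. uniformizer_L val \<iota> \<pi> \<and>
        P = {homothety_class \<iota> (integral_closure val \<iota>),
             homothety_class \<iota> ((\<lambda>x. \<pi> * x) ` integral_closure val \<iota>)})) \<or>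
     (\<exists>\<phi>. splitting_iso \<iota> \<phi> \<and>
        P = {homothety_class \<iota> (\<phi> -` (val_ring val \<times> (\<lambda>x. p powi m * x) ` val_ring val)) |m. True})"

fun basin_nbhd ::
    "('k::field \<Rightarrow> int) \<Rightarrow> 'k \<Rightarrow> ('k \<Rightarrow> 'l::comm_ring_1) \<Rightarrow> 'l set set set \<Rightarrow> nat \<Rightarrow> 'l set set set" where
  "basin_nbhd val p \<iota> P 0 = P"
| "basin_nbhd val p \<iota> P (Suc n) =
     {v \<in> tree_vertices val \<iota>. tree_setdist val p \<iota> v (basin_nbhd val p \<iota> P n) \<le> 1}"

fun layer ::
    "('k::field \<Rightarrow> int) \<Rightarrow> 'k \<Rightarrow> ('k \<Rightarrow> 'l::comm_ring_1) \<Rightarrow> 'l set set set \<Rightarrow> nat \<Rightarrow> 'l set set set" where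
  "layer val p \<iota> P 0 = P"
| "layer val p \<iota> P (Suc n) = basin_nbhd val p \<iota> P (Suc n) - basin_nbhd val p \<iota> P n"

end

theory Submission
  imports Defs
begin

text \<open>
  A lattice \<open>\<Lambda>\<close> has level at most \<open>n\<close> if \<open>p\<^sup>n\<Delta>\<close> maps it into itself, i.e. if it is an \<open>\<O>\<^sub>n\<close>-module.
  The vertices of level exactly \<open>n\<close> are the classes of the principal \<open>\<O>\<^sub>n\<close>-modules: if \<open>p\<^sup>n\<Delta>\<close>
  acted on \<open>\<Lambda>/p\<Lambda>\<close> as a scalar then the level would drop, so this action is cyclic, and a
  cyclic vector lifts to a generator of \<open>\<Lambda>\<close>. If \<open>p\<Lambda> \<subseteq> \<Lambda>' \<subseteq> \<Lambda>\<close> and \<open>\<Lambda>'\<close> has level at most \<open>n\<close>,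
  then \<open>\<Lambda>\<close> has level at most \<open>n + 1\<close>; conversely \<open>x\<O>\<^sub>n\<^sub>+\<^sub>1\<close> is adjacent to \<open>x\<O>\<^sub>n\<close>. As the basin
  consists of the classes \<open>[x\<O>\<^sub>L]\<close>, that is, of the vertices of level \<open>0\<close>, its \<open>n\<close>-th neighbourhood
  is the set of vertices of level at most \<open>n\<close>.
\<close>

section \<open>Valuations\<close>

text \<open>All that is known of \<Delta> is that O_L = O_K[\<Delta>]. Before an order has the basis
  \<open>1\<close>, \<open>\<iota> (p ^ n) * \<Delta>\<close>, the trace and norm of \<Delta> must
  be shown integral; the monic equation that integrality supplies has unknown degree and only bounds
  the coordinates of O_K[\<Delta>]. After that, lattices are studied by 2 by 2 matrices over O_K
  without separating fields from K x K: invertibility in L replaces being nonzero. The type of L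
  enters only when the basin is compared with level 0. There the classes [x O_L] amount to the
  invertible elements of L modulo nonzero scalars of K and units of O_L, which are described by a
  difference of valuations in the split case and by an exponent of a uniformizer modulo the
  ramification index e otherwise. The ramified basin is an edge, while the definition of
  ramification just says e > 1, so e = 2 has to be extracted from the dimension of L.\<close>

context local_field_char_0
begin

lemma val_one: "val 1 = 0"
  using val_mult[of 1 1] by simp

lemma val_inverse: "x \<noteq> 0 \<Longrightarrow> val (inverse x) = - val x"
  using val_mult[of x "inverse x"] val_one by simp

lemma val_power: "x \<noteq> 0 \<Longrightarrow> val (x ^ k) = int k * val x"
  by (induction k) (simp_all add: val_one val_mult algebra_simps)

lemma val_uminus: "val (- x) = val x"
proof (cases "x = 0")
  case False
  have "2 * val (- 1) = val ((- 1) * (- 1))"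
    by (subst val_mult) simp_all
  then have "val (- 1) = 0"
    by (simp add: val_one)
  then show ?thesis
    using val_mult[of "- 1" x] False by simp
qed simp

lemma val_ge_0 [simp]: "0 \<in> val_ge val k"
  by (simp add: val_ge_def)

lemma val_ge_add: "x \<in> val_ge val k \<Longrightarrow> y \<in> val_ge val k \<Longrightarrow> x + y \<in> val_ge val k"
  using val_add[of x y] by (cases "x = 0"; cases "y = 0"; cases "x + y = 0") (auto simp: val_ge_def)

lemma val_ge_uminus: "x \<in> val_ge val k \<Longrightarrow> - x \<in> val_ge val k"
  by (simp add: val_ge_def val_uminus)

lemma val_ge_diff: "x \<in> val_ge val k \<Longrightarrow> y \<in> val_ge val k \<Longrightarrow> x - y \<in> val_ge val k"
  using val_ge_add[of x k "- y"] val_ge_uminus[of y k] by simp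

lemma val_ge_mult: "x \<in> val_ge val j \<Longrightarrow> y \<in> val_ge val k \<Longrightarrow> x * y \<in> val_ge val (j + k)"
  using val_mult[of x y] by (cases "x = 0"; cases "y = 0") (auto simp: val_ge_def)

lemma val_ge_sum: "(\<And>i. i \<in> A \<Longrightarrow> f i \<in> val_ge val k) \<Longrightarrow> sum f A \<in> val_ge val k"
  by (induction A rule: infinite_finite_induct) (auto intro: val_ge_add)

lemma val_ring_mult: "x \<in> val_ring val \<Longrightarrow> y \<in> val_ring val \<Longrightarrow> x * y \<in> val_ring val"
  using val_ge_mult[of x 0 y 0] by simp

lemma val_ring_1 [simp]: "1 \<in> val_ring val"
  by (simp add: val_ge_def val_one)

lemma val_ring_power: "x \<in> val_ring val \<Longrightarrow> x ^ k \<in> val_ring val"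
  by (induction k) (auto intro: val_ring_mult)

lemmas val_ring_closed = val_ge_add val_ge_diff val_ge_uminus val_ring_mult val_ring_power

lemma inverse_in_val_ring: "x \<in> val_ring val \<Longrightarrow> x \<notin> val_ge val 1 \<Longrightarrow> inverse x \<in> val_ring val"
  by (auto simp: val_ge_def val_inverse)

lemma val_ge_common_bound:
  assumes "finite A"
  shows "\<exists>k. A \<subseteq> val_ge val k"
  using assms
proof (induction A)
  case (insert a A)
  then obtain k where "A \<subseteq> val_ge val k"
    by auto
  then have "insert a A \<subseteq> val_ge val (min k (val a))"
    by (auto simp: val_ge_def)
  then show ?case ..
qed simp

text \<open>A negative valuation would make the valuations of the powers of \<open>x\<close> tend to
  minus infinity. This turns a lower bound on norms into their integrality.\<close>

lemma powers_bounded_imp_integral: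
  assumes "\<And>k. x ^ k \<in> val_ge val m"
  shows "x \<in> val_ring val"
proof (rule ccontr)
  assume "x \<notin> val_ring val"
  then have x: "x \<noteq> 0" "val x \<le> - 1"
    by (auto simp: val_ge_def)
  define k where "k = Suc (nat \<bar>m\<bar>)"
  have "m \<le> int k * val x"
    using assms[of k] x by (simp add: val_ge_def val_power)
  also have "\<dots> \<le> int k * (- 1)"
    using x by (intro mult_left_mono) auto
  finally show False
    by (simp add: k_def)
qed

text \<open>For \<open>val x < 0\<close> the leading term of a monic equation of degree
  \<open>n\<close> has valuation \<open>n * val x\<close>, strictly below that of every other
  nonzero term, so the terms cannot cancel.\<close>

lemma integral_over_val_ring:
  assumes "lead_coeff f = 1" "\<And>i. coeff f i \<in> val_ring val" "poly f x = 0"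
  shows "x \<in> val_ring val"
proof (rule ccontr)
  assume "x \<notin> val_ring val"
  then have x: "x \<noteq> 0" "val x < 0"
    by (auto simp: val_ge_def)
  have deg: "degree f > 0"
    using assms(1,3) by (cases "degree f = 0") (auto elim: degree_eq_zeroE)
  define n where "n = degree f"
  have "poly f x = (\<Sum>i<n. coeff f i * x ^ i) + x ^ n"
    using assms(1) by (simp add: poly_altdef n_def lessThan_Suc_atMost [symmetric])
  then have "x ^ n = - (\<Sum>i<n. coeff f i * x ^ i)"
    using assms(3) by (simp add: eq_neg_iff_add_eq_0 add.commute)
  moreover have "(\<Sum>i<n. coeff f i * x ^ i) \<in> val_ge val (int (n - 1) * val x)"
  proof (rule val_ge_sum)
    fix i assume "i \<in> {..<n}"
    then have "int (n - 1) * val x \<le> int i * val x"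
      using x by (intro mult_right_mono_neg) auto
    then have "x ^ i \<in> val_ge val (int (n - 1) * val x)"
      using x by (simp add: val_ge_def val_power)
    then show "coeff f i * x ^ i \<in> val_ge val (int (n - 1) * val x)"
      using val_ge_mult[OF assms(2)[of i]] by simp
  qed
  ultimately have "x ^ n \<in> val_ge val (int (n - 1) * val x)"
    using val_ge_uminus by metis
  then have "int (n - 1) * val x \<le> val (x ^ n)"
    using x unfolding val_ge_def by auto
  moreover have "val (x ^ n) = int (n - 1) * val x + val x"
    using deg x val_mult[of "x ^ (n - 1)" x]
    by (simp add: n_def val_power power_Suc2 [symmetric] del: power_Suc)
  ultimately show False
    using x by simp
qed

end

section \<open>Linear algebra in \<open>L\<close>\<close>

context quadratic_algebra
begin

lemma \<iota>_zero [simp]: "\<iota> 0 = 0"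
  using \<iota>_add[of 0 0] by simp

lemma \<iota>_uminus: "\<iota> (- a) = - \<iota> a"
  using \<iota>_add[of a "- a"] by (simp add: eq_neg_iff_add_eq_0 add.commute)

lemma \<iota>_diff: "\<iota> (a - b) = \<iota> a - \<iota> b"
  using \<iota>_add[of a "- b"] by (simp add: \<iota>_uminus)

lemma \<iota>_power: "\<iota> (a ^ k) = \<iota> a ^ k"
  by (induction k) (simp_all add: \<iota>_one \<iota>_mult)

lemma \<iota>_sum: "\<iota> (sum f A) = (\<Sum>i\<in>A. \<iota> (f i))"
  by (induction A rule: infinite_finite_induct) (simp_all add: \<iota>_add)

lemmas \<iota>_hom = \<iota>_one \<iota>_add \<iota>_mult \<iota>_uminus \<iota>_diff \<iota>_power

lemma \<iota>_inverse: "a \<noteq> 0 \<Longrightarrow> \<iota> a * \<iota> (inverse a) = 1" "a \<noteq> 0 \<Longrightarrow> \<iota> (inverse a) * \<iota> a = 1"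
  by (simp_all add: \<iota>_mult [symmetric] \<iota>_one)

lemma \<iota>_cancel: "a \<noteq> 0 \<Longrightarrow> \<iota> a * x = \<iota> a * y \<longleftrightarrow> x = y"
  by (metis \<iota>_inverse(2) mult.assoc mult_1)

lemma poly_map_\<iota>_pCons: "poly (map_poly \<iota> (pCons c f)) x = \<iota> c + x * poly (map_poly \<iota> f) x"
  by (simp add: map_poly_pCons)

lemma vector_space_L: "vector_space (\<lambda>a x. \<iota> a * x)"
  by unfold_locales (simp_all add: \<iota>_hom algebra_simps)

text \<open>A vector outside the span would extend \<open>b\<close>, \<open>c\<close> to three
  independent vectors, more than the two-element basis \<open>B\<close> admits.\<close>

lemma independent_pair_imp_span:
  assumes "\<And>r s. \<iota> r * b + \<iota> s * c = 0 \<Longrightarrow> r = 0 \<and> s = 0"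
  shows "\<exists>r s. x = \<iota> r * b + \<iota> s * c"
proof -
  interpret V: vector_space "\<lambda>a x. \<iota> a * x"
    by (rule vector_space_L)
  obtain B where B: "V.independent B" "V.span B = UNIV" "card B = 2"
    using V.basis_exists[of UNIV] dim_2 by (metis UNIV_eq_I subset_eq UNIV_I)
  have "b \<noteq> c"
    using assms[of 1 "- 1"] by (auto simp: \<iota>_hom)
  have span2: "y \<in> V.span {b, c} \<longleftrightarrow> (\<exists>r s. y = \<iota> r * b + \<iota> s * c)" for y
  proof -
    have "y \<in> V.span {b, c} \<longleftrightarrow> (\<exists>r s. y - \<iota> r * b = \<iota> s * c)"
      by (auto simp: V.span_insert[of b] V.span_singleton)
    then show ?thesis
      by (simp add: diff_eq_eq add.commute)
  qed
  have "V.independent {b, c}"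
  proof -
    have "c \<noteq> 0"
      using assms[of 0 1] by auto
    moreover have "b \<notin> V.span {c}"
      using assms[of 1 "- k" for k] by (auto simp: V.span_singleton \<iota>_hom)
    ultimately show ?thesis
      using \<open>b \<noteq> c\<close> by (simp add: V.independent_insert)
  qed
  moreover have False if "x \<notin> V.span {b, c}"
  proof -
    have "V.independent (insert x {b, c})"
      using that \<open>V.independent {b, c}\<close> V.independent_insertI by blast
    moreover have "card (insert x {b, c}) = 3"
      using that \<open>b \<noteq> c\<close> by (auto simp: V.span_base card_insert_if)
    ultimately show False
      using V.independent_span_bound[of B "insert x {b, c}"] B by (auto simp: card_ge_0_finite)
  qed
  ultimately show ?thesis
    using span2 by blast
qed

lemma not_spanned_by_one: "\<exists>x. x \<notin> range \<iota>"
proof (rule ccontr)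
  assume *: "\<nexists>x. x \<notin> range \<iota>"
  interpret V: vector_space "\<lambda>a x. \<iota> a * x"
    by (rule vector_space_L)
  obtain B where B: "V.independent B" "card B = 2"
    using V.basis_exists[of UNIV] dim_2 by auto
  have "B \<subseteq> V.span {1}"
    using * by (auto simp: V.span_singleton)
  then show False
    using V.independent_span_bound[of "{1}" B] B by auto
qed

lemma one_independent:
  assumes "x \<notin> range \<iota>" "\<iota> r + \<iota> s * x = 0"
  shows "r = 0 \<and> s = 0"
proof -
  have "s = 0"
  proof (rule ccontr)
    assume s: "s \<noteq> 0"
    have "x = \<iota> (inverse s) * (\<iota> s * x)"
      using s by (simp add: mult.assoc [symmetric] \<iota>_inverse)
    also have "\<iota> s * x = - \<iota> r"
      using assms(2) by (simp add: eq_neg_iff_add_eq_0 add.commute)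
    finally have "x = \<iota> (- (inverse s * r))"
      by (simp add: \<iota>_hom)
    then show False
      using assms(1) by blast
  qed
  \<comment> \<open>Nontriviality of \<open>L\<close> comes from \<open>x\<close>: if
    \<open>1 = 0\<close> in \<open>L\<close>, nothing lies outside
    \<open>range \<iota>\<close>.\<close>
  moreover have "r = 0"
  proof (rule ccontr)
    assume "r \<noteq> 0"
    then have "1 = (0::'l)"
      using \<iota>_inverse(1)[of r] assms(2) \<open>s = 0\<close> by simp
    then have "x = \<iota> 0"
      by (metis \<iota>_zero mult_1 mult_zero_left)
    then show False
      using assms(1) by blast
  qed
  ultimately show ?thesis
    by simp
qed

section \<open>The orders \<open>\<O>\<^sub>n\<close>\<close>

lemma p_in_val_ring: "p \<in> val_ring val" "p ^ k \<in> val_ring val"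
  using uniformizer_K by (auto simp: val_ge_def val_power)

lemma inverse_p_notin_val_ring: "inverse p \<notin> val_ring val"
  using uniformizer_K by (simp add: val_ge_def val_inverse)

lemma val_ge_1_eq: "x \<in> val_ge val 1 \<longleftrightarrow> inverse p * x \<in> val_ring val"
  using uniformizer_K by (cases "x = 0") (auto simp: val_ge_def val_inverse val_mult)

lemma clear_denominators: "\<exists>k. p ^ k * a \<in> val_ring val \<and> p ^ k * b \<in> val_ring val"
proof -
  have "p ^ (nat \<bar>val a\<bar> + nat \<bar>val b\<bar>) * c \<in> val_ring val" if "c = a \<or> c = b" for c
    using uniformizer_K that by (cases "c = 0") (auto simp: val_ge_def val_mult val_power)
  then show ?thesis
    by blast
qed

section \<open>Integral elements and coordinates with respect to 1 and \<Delta>\<close>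

lemma integral_quadratic:
  assumes "y * y = \<iota> t * y - \<iota> d" "t \<in> val_ring val" "d \<in> val_ring val"
  shows "y \<in> integral_closure val \<iota>"
proof -
  let ?f = "[:d, - t, 1:]"
  have "poly (map_poly \<iota> ?f) y = 0"
    by (simp add: poly_map_\<iota>_pCons \<iota>_hom algebra_simps assms(1))
  moreover have "coeff ?f i \<in> val_ring val" for i
    using assms by (auto simp: coeff_pCons val_ge_uminus split: nat.split)
  ultimately show ?thesis
    unfolding integral_closure_def by (intro CollectI exI[of _ ?f]) auto
qed

lemma \<iota>_val_ring_integral:
  assumes "r \<in> val_ring val"
  shows "\<iota> r \<in> integral_closure val \<iota>"
  using assms by (intro integral_quadratic[of _ r 0]) (simp_all add: \<iota>_hom)

text \<open>Outside \<open>range \<iota>\<close> the element satisfies a monic quadratic over K;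
  multiplying it by \<open>p ^ k\<close> multiplies the trace by \<open>p ^ k\<close> and the norm
  by \<open>p ^ k * p ^ k\<close>, which makes both integral for large \<open>k\<close>. So O_L
  spans L over K.\<close>

lemma integral_multiple: "\<exists>k. \<iota> (p ^ k) * x \<in> integral_closure val \<iota>"
proof (cases "x \<in> range \<iota>")
  case True
  then obtain a where "x = \<iota> a"
    by auto
  moreover obtain k where "p ^ k * a \<in> val_ring val"
    using clear_denominators by blast
  ultimately show ?thesis
    by (metis \<iota>_mult \<iota>_val_ring_integral)
next
  case False
  obtain d t where dt: "x * x = \<iota> d * 1 + \<iota> t * x"
    using independent_pair_imp_span[of 1 x "x * x"] one_independent[OF False] by auto
  obtain k where k: "p ^ k * d \<in> val_ring val" "p ^ k * t \<in> val_ring val"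
    using clear_denominators by blast
  have "\<iota> (p ^ k) * x * (\<iota> (p ^ k) * x) = \<iota> (p ^ k * p ^ k) * (x * x)"
    by (simp add: \<iota>_mult algebra_simps)
  also have "\<dots> = \<iota> (p ^ k * t) * (\<iota> (p ^ k) * x) - \<iota> (- (p ^ k * (p ^ k * d)))"
    by (simp add: dt \<iota>_hom algebra_simps)
  finally show ?thesis
    using k by (intro exI[of _ k] integral_quadratic[of _ "p ^ k * t" "- (p ^ k * (p ^ k * d))"])
      (auto intro: val_ring_closed p_in_val_ring)
qed

lemma poly_in_range_\<iota>: "poly (map_poly \<iota> f) (\<iota> a) \<in> range \<iota>"
proof (induction f)
  case (pCons c f)
  then obtain b where "poly (map_poly \<iota> f) (\<iota> a) = \<iota> b"
    by auto
  then have "poly (map_poly \<iota> (pCons c f)) (\<iota> a) = \<iota> (c + a * b)"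
    by (simp only: poly_map_\<iota>_pCons) (simp add: \<iota>_hom)
  then show ?case
    by blast
qed (metis \<iota>_zero map_poly_0 poly_0 rangeI)

text \<open>If \<Delta> came from K, so would all of O_K[\<Delta>] = O_L, yet O_L contains some
  element outside K multiplied by a power of \<open>p\<close>.\<close>

lemma generator_not_scalar: "\<Delta> \<notin> range \<iota>"
proof
  assume "\<Delta> \<in> range \<iota>"
  then obtain a where a: "\<Delta> = \<iota> a"
    by auto
  obtain x where x: "x \<notin> range \<iota>"
    using not_spanned_by_one by blast
  obtain k where "\<iota> (p ^ k) * x \<in> adjoin val \<iota> \<Delta>"
    using integral_multiple generator by metis
  then have "\<iota> (p ^ k) * x \<in> range \<iota>"
    using poly_in_range_\<iota> by (auto simp: adjoin_def a)
  then obtain b where "\<iota> (p ^ k) * x = \<iota> b"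
    by auto
  then have "\<iota> (inverse (p ^ k)) * \<iota> (p ^ k) * x = \<iota> (inverse (p ^ k) * b)"
    by (simp add: \<iota>_mult mult.assoc)
  then have "x = \<iota> (inverse (p ^ k) * b)"
    using uniformizer_K by (simp add: \<iota>_inverse)
  then show False
    using x by blast
qed

lemmas independent_1_\<Delta> = one_independent[OF generator_not_scalar]

lemma coords_unique:
  assumes "\<iota> a + \<iota> b * \<Delta> = \<iota> a' + \<iota> b' * \<Delta>"
  shows "a = a'" "b = b'"
proof -
  have "\<iota> (a - a') + \<iota> (b - b') * \<Delta> = 0"
    using assms by (simp add: \<iota>_hom algebra_simps)
  then show "a = a'" "b = b'"
    using independent_1_\<Delta> by fastforce+
qed

lemma coords_exist: "\<exists>a b. x = \<iota> a + \<iota> b * \<Delta>"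
  using independent_pair_imp_span[of 1 \<Delta> x] independent_1_\<Delta> by auto

lemma linear_in_adjoin:
  assumes "r \<in> val_ring val" "s \<in> val_ring val"
  shows "\<iota> r + \<iota> s * a \<in> adjoin val \<iota> a"
proof -
  have "poly (map_poly \<iota> [:r, s:]) a = \<iota> r + \<iota> s * a"
    by (simp add: map_poly_pCons algebra_simps)
  moreover have "\<forall>i. coeff [:r, s:] i \<in> val_ring val"
    using assms by (auto simp: coeff_pCons split: nat.split)
  ultimately show ?thesis
    unfolding adjoin_def by (intro CollectI exI[of _ "[:r, s:]"]) simp
qed

lemma generator_integral: "\<Delta> \<in> integral_closure val \<iota>"
  unfolding generator using linear_in_adjoin[of 0 1 \<Delta>] by (simp add: \<iota>_one)

section \<open>The integral quadratic equation of \<Delta> and bases of the orders\<close>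

lemma poly_map_\<iota>_altdef: "poly (map_poly \<iota> f) x = (\<Sum>i\<le>degree f. \<iota> (coeff f i) * x ^ i)"
proof -
  have "degree (map_poly \<iota> f) \<le> degree f"
    by (rule degree_le) (simp add: coeff_map_poly coeff_eq_0)
  then have "poly (map_poly \<iota> f) x = (\<Sum>i\<le>degree f. coeff (map_poly \<iota> f) i * x ^ i)"
    unfolding poly_altdef by (intro sum.mono_neutral_left) (auto simp: coeff_eq_0)
  then show ?thesis
    by (simp add: coeff_map_poly)
qed

text \<open>\<Delta> itself is integral, so one monic equation rewrites all higher powers in terms
  of lower ones. The point is that \<open>N\<close> is chosen before \<open>x\<close>.\<close>

lemma adjoin_subset_truncation:
  "\<exists>N. \<forall>x\<in>adjoin val \<iota> \<Delta>. \<exists>c. (\<forall>i. c i \<in> val_ring val) \<and> x = (\<Sum>i<N. \<iota> (c i) * \<Delta> ^ i)"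
proof -
  obtain g where g: "lead_coeff g = 1" "\<And>i. coeff g i \<in> val_ring val"
      "poly (map_poly \<iota> g) \<Delta> = 0"
    using generator_integral by (auto simp: integral_closure_def)
  have "\<Delta> \<noteq> 0"
    using generator_not_scalar by (metis \<iota>_zero rangeI)
  then have "(1::'l) \<noteq> 0"
    by (metis mult_1 mult_zero_left)
  have "degree g \<noteq> 0"
  proof
    assume "degree g = 0"
    then have "poly (map_poly \<iota> g) \<Delta> = 1"
      using g(1) by (simp add: poly_map_\<iota>_altdef \<iota>_one)
    with g(3) \<open>(1::'l) \<noteq> 0\<close> show False
      by simp
  qed
  then obtain N where N: "degree g = Suc N"
    using not0_implies_Suc by blast
  have "poly (map_poly \<iota> g) \<Delta> = (\<Sum>i<Suc N. \<iota> (coeff g i) * \<Delta> ^ i) + \<Delta> ^ Suc N"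
    using g(1) N
    by (simp only: poly_map_\<iota>_altdef lessThan_Suc_atMost [symmetric] sum.lessThan_Suc \<iota>_one
        mult_1)
  then have top: "\<Delta> ^ Suc N = - (\<Sum>i<Suc N. \<iota> (coeff g i) * \<Delta> ^ i)"
    using g(3) by (metis add.commute eq_neg_iff_add_eq_0)
  have "\<exists>c. (\<forall>i. c i \<in> val_ring val) \<and> poly (map_poly \<iota> f) \<Delta> = (\<Sum>i<Suc N. \<iota> (c i) * \<Delta> ^ i)"
    if "\<forall>i. coeff f i \<in> val_ring val" for f
    using that
  proof (induction f)
    case 0
    show ?case
      by (intro exI[of _ "\<lambda>_. 0"]) simp
  next
    case (pCons a f)
    have "\<forall>i. coeff f i \<in> val_ring val"
      using pCons.prems by (metis coeff_pCons_Suc)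
    then obtain c where c: "\<forall>i. c i \<in> val_ring val"
        "poly (map_poly \<iota> f) \<Delta> = (\<Sum>i<Suc N. \<iota> (c i) * \<Delta> ^ i)"
      using pCons.IH by blast
    \<comment> \<open>Multiplication by \<Delta> shifts the coefficients up by one, with
      \<open>a\<close> entering at the bottom; the overflow at degree \<open>Suc N\<close> is spread
      over the lower powers by the monic equation.\<close>
    define c' where "c' i = (if i = 0 then a else c (i - 1)) - c N * coeff g i" for i
    have "poly (map_poly \<iota> (pCons a f)) \<Delta> = \<iota> a + \<Delta> * (\<Sum>i<Suc N. \<iota> (c i) * \<Delta> ^ i)"
      by (simp only: poly_map_\<iota>_pCons c)
    also have "\<dots> = \<iota> a + (\<Sum>i<N. \<iota> (c i) * \<Delta> ^ Suc i) + \<iota> (c N) * \<Delta> ^ Suc N"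
      by (simp add: sum_distrib_left algebra_simps)
    also have "\<iota> a + (\<Sum>i<N. \<iota> (c i) * \<Delta> ^ Suc i) =
        (\<Sum>i<Suc N. \<iota> (if i = 0 then a else c (i - 1)) * \<Delta> ^ i)"
      by (subst sum.lessThan_Suc_shift) simp
    also have "\<dots> + \<iota> (c N) * \<Delta> ^ Suc N = (\<Sum>i<Suc N. \<iota> (c' i) * \<Delta> ^ i)"
      unfolding top c'_def
      by (simp add: \<iota>_diff \<iota>_mult algebra_simps sum_subtractf sum_distrib_left
          del: sum.lessThan_Suc)
    finally have "poly (map_poly \<iota> (pCons a f)) \<Delta> = (\<Sum>i<Suc N. \<iota> (c' i) * \<Delta> ^ i)" .
    moreover have "a \<in> val_ring val"
      using pCons.prems by (metis coeff_pCons_0)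
    then have "\<forall>i. c' i \<in> val_ring val"
      using c g(2) by (auto simp: c'_def intro!: val_ring_closed)
    ultimately show ?case
      by blast
  qed
  then show ?thesis
    unfolding adjoin_def by (intro exI[of _ "Suc N"]) blast
qed

text \<open>Every element is an O_K-combination of the same finitely many powers of \<Delta>, and
  the coordinates of these powers have a common lower bound on their valuations.\<close>

lemma adjoin_bounded:
  "\<exists>m. \<forall>a b. \<iota> a + \<iota> b * \<Delta> \<in> adjoin val \<iota> \<Delta> \<longrightarrow> a \<in> val_ge val m \<and> b \<in> val_ge val m"
proof -
  obtain N where N: "\<And>x. x \<in> adjoin val \<iota> \<Delta> \<Longrightarrow>
      \<exists>c. (\<forall>i. c i \<in> val_ring val) \<and> x = (\<Sum>i<N. \<iota> (c i) * \<Delta> ^ i)"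
    using adjoin_subset_truncation by blast
  have "\<forall>i. \<exists>a b. \<Delta> ^ i = \<iota> a + \<iota> b * \<Delta>"
    using coords_exist by blast
  then obtain u w where uw: "\<And>i. \<Delta> ^ i = \<iota> (u i) + \<iota> (w i) * \<Delta>"
    by metis
  obtain m where m: "u ` {..<N} \<union> w ` {..<N} \<subseteq> val_ge val m"
    using val_ge_common_bound[of "u ` {..<N} \<union> w ` {..<N}"] by auto
  have "a \<in> val_ge val m \<and> b \<in> val_ge val m" if ab: "\<iota> a + \<iota> b * \<Delta> \<in> adjoin val \<iota> \<Delta>" for a b
  proof -
    obtain c where c: "\<And>i. c i \<in> val_ring val" "\<iota> a + \<iota> b * \<Delta> = (\<Sum>i<N. \<iota> (c i) * \<Delta> ^ i)"
      using N[OF ab] by blast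
    have "(\<Sum>i<N. \<iota> (c i) * \<Delta> ^ i) = \<iota> (\<Sum>i<N. c i * u i) + \<iota> (\<Sum>i<N. c i * w i) * \<Delta>"
      unfolding uw by (simp add: \<iota>_sum \<iota>_mult algebra_simps sum.distrib sum_distrib_left)
    then have "a = (\<Sum>i<N. c i * u i)" "b = (\<Sum>i<N. c i * w i)"
      using c(2) coords_unique by metis+
    moreover have "c i * u i \<in> val_ge val m" "c i * w i \<in> val_ge val m" if "i < N" for i
      using val_ge_mult[OF c(1)[of i], of _ m] m that by auto
    ultimately show ?thesis
      by (auto intro: val_ge_sum)
  qed
  then show ?thesis
    by blast
qed

lemma adjoin_mult:
  assumes "x \<in> adjoin val \<iota> a" "y \<in> adjoin val \<iota> a"
  shows "x * y \<in> adjoin val \<iota> a"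
proof -
  obtain f g where fg: "x = poly (map_poly \<iota> f) a" "\<forall>i. coeff f i \<in> val_ring val"
      "y = poly (map_poly \<iota> g) a" "\<forall>i. coeff g i \<in> val_ring val"
    using assms by (auto simp: adjoin_def)
  have "map_poly \<iota> (f * g) = map_poly \<iota> f * map_poly \<iota> g"
    by (rule poly_eqI) (simp add: coeff_map_poly coeff_mult \<iota>_sum \<iota>_mult)
  then have "x * y = poly (map_poly \<iota> (f * g)) a"
    by (simp add: fg)
  moreover have "\<forall>i. coeff (f * g) i \<in> val_ring val"
    using fg by (auto simp: coeff_mult intro!: val_ge_sum val_ring_mult)
  ultimately show ?thesis
    by (auto simp: adjoin_def)
qed

text \<open>
  The norm form \<open>a\<^sup>2 + t a b + d b\<^sup>2\<close> is multiplicative and bounded below on the bounded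
  ring \<open>\<O>\<^sub>K[\<Delta>]\<close>, hence integral there; its values at \<open>\<Delta>\<close> and \<open>1 + \<Delta>\<close> are \<open>d\<close> and \<open>1 + t + d\<close>.
\<close>

lemma generator_quadratic:
  "\<exists>t\<in>val_ring val. \<exists>d\<in>val_ring val. \<Delta> * \<Delta> = \<iota> t * \<Delta> - \<iota> d"
proof -
  obtain d' t where "\<Delta> * \<Delta> = \<iota> d' + \<iota> t * \<Delta>"
    using coords_exist by blast
  then obtain d where td: "\<Delta> * \<Delta> = \<iota> t * \<Delta> - \<iota> d"
    using \<iota>_uminus[of "- d'"] by (metis add.commute add_uminus_conv_diff minus_minus)
  define N where "N a b = a * a + t * a * b + d * b * b" for a b
  obtain m where m: "\<And>a b. \<iota> a + \<iota> b * \<Delta> \<in> adjoin val \<iota> \<Delta> \<Longrightarrow> a \<in> val_ge val m \<and> b \<in> val_ge val m"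
    using adjoin_bounded by blast
  \<comment> \<open>\<open>m'\<close> bounds the three coefficients of the form, including the
    coefficient 1 of \<open>a * a\<close>; two further factors bounded by \<open>m\<close> give
    \<open>m' + m + m\<close>.\<close>
  obtain m' where m': "{1, t, d} \<subseteq> val_ge val m'"
    using val_ge_common_bound[of "{1, t, d}"] by auto
  have N_bounded: "N a b \<in> val_ge val (m' + m + m)"
    if "\<iota> a + \<iota> b * \<Delta> \<in> adjoin val \<iota> \<Delta>" for a b
  proof -
    have "1 * a * a \<in> val_ge val (m' + m + m)" "t * a * b \<in> val_ge val (m' + m + m)"
      "d * b * b \<in> val_ge val (m' + m + m)"
      using m[OF that] m' by (safe intro!: val_ge_mult; blast)+
    then show ?thesis
      unfolding N_def by (auto intro!: val_ge_add)
  qed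
  have N_integral: "N a b \<in> val_ring val" if ab: "a \<in> val_ring val" "b \<in> val_ring val" for a b
  proof (rule powers_bounded_imp_integral)
    fix k
    \<comment> \<open>\<open>a'\<close> and \<open>b'\<close> are the coordinates of the
      \<open>k\<close>-th power of \<open>\<iota> a + \<iota> b * \<Delta>\<close>.\<close>
    have "\<exists>a' b'. \<iota> a' + \<iota> b' * \<Delta> \<in> adjoin val \<iota> \<Delta> \<and> N a' b' = N a b ^ k"
    proof (induction k)
      case 0
      show ?case
        using linear_in_adjoin[of 1 0 \<Delta>] by (intro exI[of _ 1] exI[of _ 0]) (simp add: N_def)
    next
      case (Suc k)
      then obtain a' b' where a'b': "\<iota> a' + \<iota> b' * \<Delta> \<in> adjoin val \<iota> \<Delta>" "N a' b' = N a b ^ k"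
        by blast
      have "(\<iota> a + \<iota> b * \<Delta>) * (\<iota> a' + \<iota> b' * \<Delta>) =
          \<iota> a * \<iota> a' + (\<iota> a * \<iota> b' + \<iota> a' * \<iota> b) * \<Delta> + \<iota> b * \<iota> b' * (\<Delta> * \<Delta>)"
        by (simp add: algebra_simps)
      also have "\<dots> = \<iota> (a * a' - d * b * b') + \<iota> (a * b' + a' * b + t * b * b') * \<Delta>"
        unfolding td by (simp add: \<iota>_hom algebra_simps)
      finally have "\<iota> (a * a' - d * b * b') + \<iota> (a * b' + a' * b + t * b * b') * \<Delta>
          \<in> adjoin val \<iota> \<Delta>"
        using adjoin_mult[OF linear_in_adjoin[OF ab] a'b'(1)] by simp
      moreover have "N (a * a' - d * b * b') (a * b' + a' * b + t * b * b') = N a b * N a' b'"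
        unfolding N_def by algebra
      ultimately show ?case
        using a'b'(2) by (metis power_Suc)
    qed
    then show "N a b ^ k \<in> val_ge val (m' + m + m)"
      using N_bounded by metis
  qed
  have d: "d \<in> val_ring val"
    using N_integral[of 0 1] by (simp add: N_def)
  have "1 + t + d - 1 - d \<in> val_ring val"
    using N_integral[of 1 1] d by (intro val_ge_diff) (simp_all add: N_def)
  then have "t \<in> val_ring val"
    by simp
  then show ?thesis
    using d td by blast
qed

lemma adjoin_eq_linear:
  assumes "a * a = \<iota> t * a - \<iota> d" "t \<in> val_ring val" "d \<in> val_ring val"
  shows "adjoin val \<iota> a = {\<iota> r + \<iota> s * a |r s. r \<in> val_ring val \<and> s \<in> val_ring val}"
proof
  have "\<exists>r s. poly (map_poly \<iota> f) a = \<iota> r + \<iota> s * a \<and> r \<in> val_ring val \<and> s \<in> val_ring val"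
    if "\<forall>i. coeff f i \<in> val_ring val" for f
    using that
  proof (induction f)
    case 0
    show ?case
      by (intro exI[of _ 0]) simp
  next
    case (pCons c f)
    have "\<forall>i. coeff f i \<in> val_ring val"
      using pCons.prems by (metis coeff_pCons_Suc)
    then obtain r s where rs: "poly (map_poly \<iota> f) a = \<iota> r + \<iota> s * a"
        "r \<in> val_ring val" "s \<in> val_ring val"
      using pCons.IH by blast
    have "poly (map_poly \<iota> (pCons c f)) a = \<iota> c + \<iota> r * a + \<iota> s * (a * a)"
      by (simp only: poly_map_\<iota>_pCons rs) (simp add: algebra_simps)
    also have "\<dots> = \<iota> (c - s * d) + \<iota> (r + s * t) * a"
      unfolding assms(1) by (simp add: \<iota>_hom algebra_simps)
    finally have "poly (map_poly \<iota> (pCons c f)) a = \<iota> (c - s * d) + \<iota> (r + s * t) * a" .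
    moreover have "c \<in> val_ring val"
      using pCons.prems by (metis coeff_pCons_0)
    ultimately show ?case
      using rs assms(2,3) by (blast intro: val_ring_closed)
  qed
  then show "adjoin val \<iota> a \<subseteq> {\<iota> r + \<iota> s * a |r s. r \<in> val_ring val \<and> s \<in> val_ring val}"
    by (auto simp: adjoin_def)
  show "{\<iota> r + \<iota> s * a |r s. r \<in> val_ring val \<and> s \<in> val_ring val} \<subseteq> adjoin val \<iota> a"
    using linear_in_adjoin by auto
qed

text \<open>If \<Delta> has trace \<open>t\<close> and norm \<open>d\<close>, then
  \<open>\<iota> (p ^ n) * \<Delta>\<close> has trace \<open>p ^ n * t\<close> and norm
  \<open>p ^ n * p ^ n * d\<close>, again integral, so all its powers reduce to linear
  expressions.\<close>

lemma quadratic_order_eq: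
  "quadratic_order val p \<iota> \<Delta> n =
    {\<iota> r + \<iota> s * (\<iota> (p ^ n) * \<Delta>) |r s. r \<in> val_ring val \<and> s \<in> val_ring val}"
proof -
  obtain t d where td: "t \<in> val_ring val" "d \<in> val_ring val" "\<Delta> * \<Delta> = \<iota> t * \<Delta> - \<iota> d"
    using generator_quadratic by blast
  have "\<iota> (p ^ n) * \<Delta> * (\<iota> (p ^ n) * \<Delta>) = \<iota> (p ^ n * p ^ n) * (\<Delta> * \<Delta>)"
    by (simp add: \<iota>_mult algebra_simps)
  also have "\<dots> = \<iota> (p ^ n * t) * (\<iota> (p ^ n) * \<Delta>) - \<iota> (p ^ n * p ^ n * d)"
    unfolding td(3) by (simp add: \<iota>_mult algebra_simps)
  finally show ?thesis
    unfolding quadratic_order_def using td(1,2)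
    by (intro adjoin_eq_linear[of _ "p ^ n * t" "p ^ n * p ^ n * d"])
      (auto intro: val_ring_mult p_in_val_ring)
qed

lemma integral_closure_eq_order: "integral_closure val \<iota> = quadratic_order val p \<iota> \<Delta> 0"
  by (simp add: generator quadratic_order_def \<iota>_one)

lemma quadratic_order_mult:
  "x \<in> quadratic_order val p \<iota> \<Delta> n \<Longrightarrow> y \<in> quadratic_order val p \<iota> \<Delta> n \<Longrightarrow>
    x * y \<in> quadratic_order val p \<iota> \<Delta> n"
  unfolding quadratic_order_def by (rule adjoin_mult)

section \<open>Lattices stable under an order\<close>

definition lattice :: "'l \<Rightarrow> 'l \<Rightarrow> 'l set" where
  "lattice b c = {\<iota> r * b + \<iota> s * c |r s. r \<in> val_ring val \<and> s \<in> val_ring val}"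

definition indep :: "'l \<Rightarrow> 'l \<Rightarrow> bool" where
  "indep b c \<longleftrightarrow> (\<forall>r s. \<iota> r * b + \<iota> s * c = 0 \<longrightarrow> r = 0 \<and> s = 0)"

definition stable :: "nat \<Rightarrow> 'l set \<Rightarrow> bool" where
  "stable n \<Lambda> \<longleftrightarrow> (\<forall>x\<in>\<Lambda>. \<iota> (p ^ n) * \<Delta> * x \<in> \<Lambda>)"

abbreviation order_n :: "nat \<Rightarrow> 'l set" where
  "order_n \<equiv> quadratic_order val p \<iota> \<Delta>"

lemma latticeI:
  "r \<in> val_ring val \<Longrightarrow> s \<in> val_ring val \<Longrightarrow> x = \<iota> r * b + \<iota> s * c \<Longrightarrow> x \<in> lattice b c"
  by (auto simp: lattice_def)

lemma latticeE:
  assumes "x \<in> lattice b c"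
  obtains r s where "r \<in> val_ring val" "s \<in> val_ring val" "x = \<iota> r * b + \<iota> s * c"
  using assms by (auto simp: lattice_def)

lemma lattice_basis: "b \<in> lattice b c" "c \<in> lattice b c"
  by (rule latticeI[of 1 0]; simp add: \<iota>_one) (rule latticeI[of 0 1]; simp add: \<iota>_one)

lemma lattice_linear:
  assumes "x \<in> lattice b c" "y \<in> lattice b c" "r \<in> val_ring val" "s \<in> val_ring val"
  shows "\<iota> r * x + \<iota> s * y \<in> lattice b c"
proof -
  obtain a a' where a: "a \<in> val_ring val" "a' \<in> val_ring val" "x = \<iota> a * b + \<iota> a' * c"
    using assms(1) by (rule latticeE)
  obtain d d' where d: "d \<in> val_ring val" "d' \<in> val_ring val" "y = \<iota> d * b + \<iota> d' * c"
    using assms(2) by (rule latticeE)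
  show ?thesis
    by (rule latticeI[of "r * a + s * d" "r * a' + s * d'"])
      (use a d assms in \<open>auto intro!: val_ring_closed simp: \<iota>_hom algebra_simps\<close>)
qed

lemma lattice_subset: "x \<in> lattice b c \<Longrightarrow> y \<in> lattice b c \<Longrightarrow> lattice x y \<subseteq> lattice b c"
  by (auto elim!: latticeE[of _ x y] intro: lattice_linear)

text \<open>The definition tests independence only on coefficients in the valuation ring;
  multiplying a relation over K by a power of \<open>p\<close> reduces to that case.\<close>

lemma free_rank_2_iff: "free_rank_2 val \<iota> \<Lambda> \<longleftrightarrow> (\<exists>b c. \<Lambda> = lattice b c \<and> indep b c)"
proof -
  have "indep b c \<longleftrightarrow>
      (\<forall>r\<in>val_ring val. \<forall>s\<in>val_ring val. \<iota> r * b + \<iota> s * c = 0 \<longrightarrow> r = 0 \<and> s = 0)" for b c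
  proof
    assume *: "\<forall>r\<in>val_ring val. \<forall>s\<in>val_ring val. \<iota> r * b + \<iota> s * c = 0 \<longrightarrow> r = 0 \<and> s = 0"
    show "indep b c"
      unfolding indep_def
    proof (intro allI impI)
      fix r s
      assume "\<iota> r * b + \<iota> s * c = 0"
      obtain k where k: "p ^ k * r \<in> val_ring val" "p ^ k * s \<in> val_ring val"
        using clear_denominators by blast
      have "\<iota> (p ^ k * r) * b + \<iota> (p ^ k * s) * c = \<iota> (p ^ k) * (\<iota> r * b + \<iota> s * c)"
        by (simp add: \<iota>_mult algebra_simps)
      also have "\<dots> = 0"
        using \<open>\<iota> r * b + \<iota> s * c = 0\<close> by simp
      finally have "p ^ k * r = 0 \<and> p ^ k * s = 0"
        using * k by blast
      then show "r = 0 \<and> s = 0"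
        using uniformizer_K by simp
    qed
  qed (auto simp: indep_def)
  then show ?thesis
    by (simp add: free_rank_2_def lattice_def)
qed

text \<open>Cayley-Hamilton: in the basis \<open>b\<close>, \<open>c\<close> multiplication by
  \<open>y\<close> has an integral matrix with trace \<open>r + w\<close> and determinant
  \<open>r * w - s * u\<close>. The value \<open>?z\<close> of its characteristic polynomial at
  \<open>y\<close> kills \<open>b\<close> and \<open>c\<close>, which span L, so it kills 1 and is
  zero.\<close>

lemma stabilizer_integral:
  assumes "indep b c" "y * b \<in> lattice b c" "y * c \<in> lattice b c"
  shows "y \<in> integral_closure val \<iota>"
proof -
  obtain r s where rs: "r \<in> val_ring val" "s \<in> val_ring val" "y * b = \<iota> r * b + \<iota> s * c"
    using assms(2) by (rule latticeE)
  obtain u w where uw: "u \<in> val_ring val" "w \<in> val_ring val" "y * c = \<iota> u * b + \<iota> w * c"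
    using assms(3) by (rule latticeE)
  let ?z = "y * y - \<iota> (r + w) * y + \<iota> (r * w - s * u)"
  have "?z * b = y * (y * b) - \<iota> (r + w) * (y * b) + \<iota> (r * w - s * u) * b"
    by (simp add: algebra_simps)
  also have "y * (y * b) = \<iota> r * (y * b) + \<iota> s * (y * c)"
    by (subst rs(3)) (simp add: algebra_simps)
  finally have zb: "?z * b = 0"
    unfolding rs(3) uw(3) by (simp add: \<iota>_hom algebra_simps)
  have "?z * c = y * (y * c) - \<iota> (r + w) * (y * c) + \<iota> (r * w - s * u) * c"
    by (simp add: algebra_simps)
  also have "y * (y * c) = \<iota> u * (y * b) + \<iota> w * (y * c)"
    by (subst uw(3)) (simp add: algebra_simps)
  finally have zc: "?z * c = 0"
    unfolding rs(3) uw(3) by (simp add: \<iota>_hom algebra_simps)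
  obtain k l where "1 = \<iota> k * b + \<iota> l * c"
    using independent_pair_imp_span[of b c 1] assms(1) by (auto simp: indep_def)
  then have "?z = ?z * (\<iota> k * b + \<iota> l * c)"
    by (metis mult.right_neutral)
  also have "\<dots> = \<iota> k * (?z * b) + \<iota> l * (?z * c)"
    by (simp only: distrib_left mult.left_commute)
  also have "\<dots> = 0"
    by (simp only: zb zc) simp
  finally have "y * y = \<iota> (r + w) * y - \<iota> (r * w - s * u)"
    by (simp add: algebra_simps)
  then show ?thesis
    using rs uw by (intro integral_quadratic[of y "r + w" "r * w - s * u"])
      (auto intro!: val_ring_closed)
qed

lemma order_n_iff:
  "\<iota> a + \<iota> b * \<Delta> \<in> order_n n \<longleftrightarrow> a \<in> val_ring val \<and> (\<exists>s\<in>val_ring val. b = s * p ^ n)"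
proof
  assume "\<iota> a + \<iota> b * \<Delta> \<in> order_n n"
  then obtain r s where rs: "r \<in> val_ring val" "s \<in> val_ring val"
      "\<iota> a + \<iota> b * \<Delta> = \<iota> r + \<iota> s * (\<iota> (p ^ n) * \<Delta>)"
    by (auto simp: quadratic_order_eq)
  then have "\<iota> a + \<iota> b * \<Delta> = \<iota> r + \<iota> (s * p ^ n) * \<Delta>"
    by (simp add: \<iota>_mult mult.assoc)
  then have "a = r" "b = s * p ^ n"
    by (rule coords_unique)+
  then show "a \<in> val_ring val \<and> (\<exists>s\<in>val_ring val. b = s * p ^ n)"
    using rs by blast
qed (unfold quadratic_order_eq, auto simp: \<iota>_mult mult.assoc, blast)

lemma principal_eq_lattice: "(\<lambda>y. x * y) ` order_n n = lattice x (\<iota> (p ^ n) * \<Delta> * x)"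
proof -
  have "(\<lambda>y. x * y) ` order_n n =
      {x * (\<iota> r + \<iota> s * (\<iota> (p ^ n) * \<Delta>)) |r s. r \<in> val_ring val \<and> s \<in> val_ring val}"
    unfolding quadratic_order_eq by blast
  also have "\<dots> = lattice x (\<iota> (p ^ n) * \<Delta> * x)"
    unfolding lattice_def by (simp add: algebra_simps)
  finally show ?thesis .
qed

lemma indep_multiples_imp_unit:
  assumes "indep (a * b) (a * c)"
  shows "\<exists>a'. a * a' = 1"
proof -
  obtain r s where "1 = \<iota> r * (a * b) + \<iota> s * (a * c)"
    using independent_pair_imp_span[of "a * b" "a * c" 1] assms by (auto simp: indep_def)
  then have "a * (\<iota> r * b + \<iota> s * c) = 1"
    by (simp add: algebra_simps)
  then show ?thesis ..
qed

text \<open>In the split case \<open>a\<close> may be a nonzero zero divisor, whose multiples have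
  rank below 2. Rank 2 yields two independent multiples of \<open>a\<close>; they span L, so 1 is a
  multiple of \<open>a\<close>. The inverse is sought in L, not in the order.\<close>

lemma principal_free_iff_unit:
  "free_rank_2 val \<iota> ((\<lambda>y. a * y) ` order_n n) \<longleftrightarrow> (\<exists>a'. a * a' = 1)"
proof
  assume "free_rank_2 val \<iota> ((\<lambda>y. a * y) ` order_n n)"
  then obtain b c where bc: "(\<lambda>y. a * y) ` order_n n = lattice b c" "indep b c"
    by (auto simp: free_rank_2_iff)
  have "b \<in> (\<lambda>y. a * y) ` order_n n" "c \<in> (\<lambda>y. a * y) ` order_n n"
    using bc(1) lattice_basis by auto
  then show "\<exists>a'. a * a' = 1"
    using bc(2) indep_multiples_imp_unit by blast
next
  assume "\<exists>a'. a * a' = 1"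
  then obtain a' where a': "a * a' = 1" ..
  have "indep a (\<iota> (p ^ n) * \<Delta> * a)"
    unfolding indep_def
  proof (intro allI impI)
    fix r s
    assume "\<iota> r * a + \<iota> s * (\<iota> (p ^ n) * \<Delta> * a) = 0"
    moreover have "(\<iota> r + \<iota> (s * p ^ n) * \<Delta>) * (a * a') =
        (\<iota> r * a + \<iota> s * (\<iota> (p ^ n) * \<Delta> * a)) * a'"
      by (simp add: \<iota>_mult algebra_simps)
    ultimately have "(\<iota> r + \<iota> (s * p ^ n) * \<Delta>) * (a * a') = 0"
      by simp
    then have "\<iota> r + \<iota> (s * p ^ n) * \<Delta> = 0"
      by (simp add: a')
    then show "r = 0 \<and> s = 0"
      using independent_1_\<Delta> uniformizer_K by fastforce
  qed
  then show "free_rank_2 val \<iota> ((\<lambda>y. a * y) ` order_n n)"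
    by (auto simp: free_rank_2_iff principal_eq_lattice)
qed

text \<open>
  Multiplication by \<open>p\<^sup>n\<Delta>\<close> on \<open>\<Lambda>/p\<Lambda>\<close> is cyclic unless it is a scalar \<open>\<alpha>\<close>. In the latter case
  \<open>(p\<^sup>n\<Delta> - \<alpha>)/p\<close> stabilizes \<open>\<Lambda>\<close>, so it is integral; comparing coordinates with respect to
  \<open>1, \<Delta>\<close> yields \<open>n > 0\<close> and that \<open>\<Lambda>\<close> is already stable under \<open>p\<^sup>n\<^sup>-\<^sup>1\<Delta>\<close>.
\<close>

lemma stable_imp_principal:
  assumes "free_rank_2 val \<iota> \<Lambda>" "stable n \<Lambda>" "n = 0 \<or> \<not> stable (n - 1) \<Lambda>"
  shows "\<exists>x. \<Lambda> = (\<lambda>y. x * y) ` order_n n"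
proof -
  obtain b c where \<Lambda>: "\<Lambda> = lattice b c" and bc: "indep b c"
    using assms(1) by (auto simp: free_rank_2_iff)
  define \<tau> where "\<tau> = \<iota> (p ^ n) * \<Delta>"
  have \<tau>_stable: "\<tau> * x \<in> lattice b c" if "x \<in> lattice b c" for x
    using assms(2) that by (simp add: stable_def \<tau>_def \<Lambda>)
  have principal: ?thesis
    if "x \<in> lattice b c" "b \<in> lattice x (\<tau> * x)" "c \<in> lattice x (\<tau> * x)" for x
  proof -
    have "lattice b c = lattice x (\<tau> * x)"
      using that \<tau>_stable by (intro equalityI lattice_subset)
    then show ?thesis
      unfolding \<Lambda> principal_eq_lattice \<tau>_def by blast
  qed
  obtain \<alpha> \<gamma> where \<alpha>: "\<alpha> \<in> val_ring val" and \<gamma>: "\<gamma> \<in> val_ring val"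
      and \<tau>b: "\<tau> * b = \<iota> \<alpha> * b + \<iota> \<gamma> * c"
    using \<tau>_stable[OF lattice_basis(1)] by (rule latticeE)
  obtain \<beta> \<delta> where \<beta>: "\<beta> \<in> val_ring val" and \<delta>: "\<delta> \<in> val_ring val"
      and \<tau>c: "\<tau> * c = \<iota> \<beta> * b + \<iota> \<delta> * c"
    using \<tau>_stable[OF lattice_basis(2)] by (rule latticeE)
  \<comment> \<open>The first three cases cover every matrix of \<open>\<tau>\<close> that is not
    scalar modulo \<open>p\<close>, with cyclic vectors \<open>b\<close>, \<open>c\<close> and
    \<open>b + c\<close> respectively. An integral entry outside \<open>val_ge val 1\<close> is a
    unit and can be divided by.\<close>
  consider "\<gamma> \<notin> val_ge val 1" | "\<beta> \<notin> val_ge val 1"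
    | "\<gamma> \<in> val_ge val 1" "\<beta> \<in> val_ge val 1" "\<delta> - \<alpha> \<notin> val_ge val 1"
    | "\<gamma> \<in> val_ge val 1" "\<beta> \<in> val_ge val 1" "\<delta> - \<alpha> \<in> val_ge val 1"
    by blast
  then show ?thesis
  proof cases
    case 1
    then have g: "\<gamma> \<noteq> 0" "inverse \<gamma> \<in> val_ring val"
      using \<gamma> inverse_in_val_ring by auto
    have "\<iota> (- (inverse \<gamma> * \<alpha>)) * b + \<iota> (inverse \<gamma>) * (\<tau> * b) = \<iota> (inverse \<gamma>) * \<iota> \<gamma> * c"
      unfolding \<tau>b by (simp add: \<iota>_hom algebra_simps)
    then have "c = \<iota> (- (inverse \<gamma> * \<alpha>)) * b + \<iota> (inverse \<gamma>) * (\<tau> * b)"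
      using g by (simp add: \<iota>_inverse)
    then show ?thesis
      using g \<alpha> by (intro principal[of b] lattice_basis latticeI) (auto intro!: val_ring_closed)
  next
    case 2
    then have g: "\<beta> \<noteq> 0" "inverse \<beta> \<in> val_ring val"
      using \<beta> inverse_in_val_ring by auto
    have "\<iota> (- (inverse \<beta> * \<delta>)) * c + \<iota> (inverse \<beta>) * (\<tau> * c) = \<iota> (inverse \<beta>) * \<iota> \<beta> * b"
      unfolding \<tau>c by (simp add: \<iota>_hom algebra_simps)
    then have "b = \<iota> (- (inverse \<beta> * \<delta>)) * c + \<iota> (inverse \<beta>) * (\<tau> * c)"
      using g by (simp add: \<iota>_inverse)
    then show ?thesis
      using g \<delta> by (intro principal[of c] lattice_basis latticeI) (auto intro!: val_ring_closed)
  next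
    case 3
    \<comment> \<open>Modulo \<open>p\<close> the matrix is diagonal with distinct entries, so
      \<open>b + c\<close> is cyclic. \<open>D\<close> is the exact coefficient of \<open>c\<close>
      in \<open>\<tau> * x - \<iota> (\<alpha> + \<beta>) * x\<close>.\<close>
    define D where "D = (\<delta> - \<alpha>) + (\<gamma> - \<beta>)"
    have "D \<notin> val_ge val 1"
    proof
      assume "D \<in> val_ge val 1"
      then have "D - (\<gamma> - \<beta>) \<in> val_ge val 1"
        using 3 by (intro val_ge_diff)
      then show False
        using 3 by (simp add: D_def)
    qed
    moreover have "D \<in> val_ring val"
      using \<alpha> \<beta> \<gamma> \<delta> by (auto simp: D_def intro!: val_ring_closed)
    ultimately have g: "D \<noteq> 0" "inverse D \<in> val_ring val"
      using inverse_in_val_ring by auto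
    define x where "x = b + c"
    have "\<tau> * x = \<iota> (\<alpha> + \<beta>) * x + \<iota> D * c"
      unfolding x_def distrib_left \<tau>b \<tau>c by (simp add: D_def \<iota>_hom algebra_simps)
    then have "\<iota> (- (inverse D * (\<alpha> + \<beta>))) * x + \<iota> (inverse D) * (\<tau> * x) =
        \<iota> (inverse D) * \<iota> D * c"
      by (simp add: \<iota>_hom algebra_simps)
    then have c: "c = \<iota> (- (inverse D * (\<alpha> + \<beta>))) * x + \<iota> (inverse D) * (\<tau> * x)"
      using g by (simp add: \<iota>_inverse)
    have c_in: "c \<in> lattice x (\<tau> * x)"
      using g \<alpha> \<beta> by (intro latticeI[OF _ _ c]) (auto intro!: val_ring_closed)
    have "\<iota> 1 * x + \<iota> (- 1) * c \<in> lattice x (\<tau> * x)"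
      using c_in lattice_basis by (intro lattice_linear) (auto intro!: val_ring_closed)
    then have "b \<in> lattice x (\<tau> * x)"
      by (simp add: \<iota>_hom x_def)
    moreover have "x \<in> lattice b c"
      by (rule latticeI[of 1 1]) (simp_all add: \<iota>_one x_def)
    ultimately show ?thesis
      using c_in by (intro principal)
  next
    case 4
    define y where "y = \<iota> (inverse p) * (\<tau> - \<iota> \<alpha>)"
    have "y * b = \<iota> (inverse p) * (\<tau> * b - \<iota> \<alpha> * b)"
      by (simp add: y_def algebra_simps)
    also have "\<dots> = \<iota> 0 * b + \<iota> (inverse p * \<gamma>) * c"
      unfolding \<tau>b by (simp add: \<iota>_hom algebra_simps)
    finally have yb: "y * b \<in> lattice b c"
      using 4 by (intro latticeI[of 0 "inverse p * \<gamma>"]) (auto simp: val_ge_1_eq)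
    have "y * c = \<iota> (inverse p) * (\<tau> * c - \<iota> \<alpha> * c)"
      by (simp add: y_def algebra_simps)
    also have "\<dots> = \<iota> (inverse p * \<beta>) * b + \<iota> (inverse p * (\<delta> - \<alpha>)) * c"
      unfolding \<tau>c by (simp add: \<iota>_hom algebra_simps)
    finally have yc: "y * c \<in> lattice b c"
      using 4 by (intro latticeI[of "inverse p * \<beta>" "inverse p * (\<delta> - \<alpha>)"])
        (auto simp: val_ge_1_eq)
    have y: "y = \<iota> (- (inverse p * \<alpha>)) + \<iota> (inverse p * p ^ n) * \<Delta>"
      by (simp add: y_def \<tau>_def \<iota>_hom algebra_simps)
    have "y \<in> order_n 0"
      using stabilizer_integral[OF bc yb yc] integral_closure_eq_order by simp
    then have int: "- (inverse p * \<alpha>) \<in> val_ring val" "inverse p * p ^ n \<in> val_ring val"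
      unfolding y order_n_iff by auto
    then have "n \<noteq> 0"
      using inverse_p_notin_val_ring by (cases n) auto
    then have pn: "inverse p * p ^ n = p ^ (n - 1)"
      using uniformizer_K by (cases n) auto
    have "stable (n - 1) \<Lambda>"
      unfolding stable_def
    proof
      fix z assume "z \<in> \<Lambda>"
      then obtain r s where rs: "r \<in> val_ring val" "s \<in> val_ring val" "z = \<iota> r * b + \<iota> s * c"
        unfolding \<Lambda> by (rule latticeE)
      have "y * z = \<iota> r * (y * b) + \<iota> s * (y * c)"
        by (simp add: rs algebra_simps)
      then have "y * z \<in> lattice b c"
        using yb yc rs by (auto intro: lattice_linear)
      \<comment> \<open>Adding the integral scalar \<open>inverse p * \<alpha>\<close> back to
        \<open>y\<close> leaves multiplication by
        \<open>\<iota> (p ^ (n - 1)) * \<Delta>\<close>.\<close>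
      then have "\<iota> 1 * (y * z) + \<iota> (inverse p * \<alpha>) * z \<in> \<Lambda>"
        using int(1) \<open>z \<in> \<Lambda>\<close> val_ge_uminus[OF int(1)] unfolding \<Lambda> by (intro lattice_linear) auto
      moreover have "\<iota> 1 * (y * z) + \<iota> (inverse p * \<alpha>) * z = \<iota> (p ^ (n - 1)) * \<Delta> * z"
        unfolding y pn by (simp add: \<iota>_uminus \<iota>_one algebra_simps)
      ultimately show "\<iota> (p ^ (n - 1)) * \<Delta> * z \<in> \<Lambda>"
        by simp
    qed
    then show ?thesis
      using assms(3) \<open>n \<noteq> 0\<close> by blast
  qed
qed

text \<open>As \<open>a\<close> is invertible, \<open>\<iota> (p ^ m) * \<Delta>\<close> stabilizes
  the module exactly when it lies in \<open>order_n n\<close>, that is, when \<open>p ^ n\<close>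
  divides \<open>p ^ m\<close> in O_K. So such a module has level exactly \<open>n\<close>.\<close>

lemma principal_stable_iff:
  assumes "a * a' = 1"
  shows "stable m ((\<lambda>y. a * y) ` order_n n) \<longleftrightarrow> n \<le> m"
proof
  have tau: "\<iota> (p ^ m) * \<Delta> \<in> order_n n" if "n \<le> m" for m n
  proof -
    have "p ^ m = p ^ (m - n) * p ^ n"
      using that by (simp add: power_add [symmetric])
    then have "\<iota> 0 + \<iota> (p ^ m) * \<Delta> \<in> order_n n"
      unfolding order_n_iff using p_in_val_ring(2) val_ge_0 by blast
    then show ?thesis
      by simp
  qed
  {
    assume "n \<le> m"
    have "\<iota> (p ^ m) * \<Delta> * (a * y) \<in> (\<lambda>y. a * y) ` order_n n" if "y \<in> order_n n" for y
    proof -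
      have "\<iota> (p ^ m) * \<Delta> * (a * y) = a * (\<iota> (p ^ m) * \<Delta> * y)"
        by (simp add: algebra_simps)
      then show ?thesis
        using quadratic_order_mult[OF tau[OF \<open>n \<le> m\<close>] that] by blast
    qed
    then show "stable m ((\<lambda>y. a * y) ` order_n n)"
      by (auto simp: stable_def)
  }
  assume "stable m ((\<lambda>y. a * y) ` order_n n)"
  moreover have "a \<in> (\<lambda>y. a * y) ` order_n n"
    by (simp add: principal_eq_lattice lattice_basis)
  ultimately have "\<iota> (p ^ m) * \<Delta> * a \<in> (\<lambda>y. a * y) ` order_n n"
    by (auto simp: stable_def)
  then obtain y where y: "y \<in> order_n n" "\<iota> (p ^ m) * \<Delta> * a = a * y"
    by auto
  have "\<iota> (p ^ m) * \<Delta> = \<iota> (p ^ m) * \<Delta> * a * a'"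
    using assms by (simp add: mult.assoc)
  also have "\<dots> = y * (a * a')"
    unfolding y(2) by (simp add: algebra_simps)
  finally have "\<iota> 0 + \<iota> (p ^ m) * \<Delta> \<in> order_n n"
    using y(1) assms by simp
  then obtain s where "s \<in> val_ring val" "p ^ m = s * p ^ n"
    unfolding order_n_iff by blast
  moreover from this have "s \<noteq> 0"
    using uniformizer_K by auto
  ultimately have "val (p ^ m) = val s + val (p ^ n)" "0 \<le> val s"
    using uniformizer_K by (simp_all add: val_mult val_ge_def)
  then show "n \<le> m"
    using uniformizer_K by (simp add: val_power)
qed

section \<open>Homothety classes and the tree\<close>

lemma homothety_class_self: "\<Lambda> \<in> homothety_class \<iota> \<Lambda>"
  unfolding homothety_class_def by (intro CollectI exI[of _ 1]) (simp add: \<iota>_one)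

lemma homothety_class_scale:
  assumes "a \<noteq> 0"
  shows "homothety_class \<iota> ((\<lambda>x. \<iota> a * x) ` \<Lambda>) = homothety_class \<iota> \<Lambda>"
proof -
  have "(\<lambda>x. \<iota> b * x) ` (\<lambda>x. \<iota> a * x) ` \<Lambda> = (\<lambda>x. \<iota> (b * a) * x) ` \<Lambda>" for b
    by (simp add: image_image \<iota>_mult mult.assoc)
  moreover have "(\<lambda>x. \<iota> b * x) ` \<Lambda> = (\<lambda>x. \<iota> (b * inverse a * a) * x) ` \<Lambda>" for b
    using assms by (simp add: mult.assoc)
  ultimately show ?thesis
    using assms unfolding homothety_class_def
    by (smt (verit) Collect_cong inverse_nonzero_iff_nonzero mult_eq_0_iff)
qed

lemma homothety_class_eqD:
  "homothety_class \<iota> \<Lambda> = homothety_class \<iota> \<Lambda>' \<Longrightarrow> \<exists>a. a \<noteq> 0 \<and> \<Lambda> = (\<lambda>x. \<iota> a * x) ` \<Lambda>'"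
  using homothety_class_self[of \<Lambda>] by (auto simp: homothety_class_def)

lemma stable_scale:
  assumes "stable n \<Lambda>"
  shows "stable n ((\<lambda>x. \<iota> a * x) ` \<Lambda>)"
  unfolding stable_def
proof (rule ballI, erule imageE)
  fix x z
  assume "z = \<iota> a * x" "x \<in> \<Lambda>"
  then have "\<iota> (p ^ n) * \<Delta> * z = \<iota> a * (\<iota> (p ^ n) * \<Delta> * x)"
    by (simp add: algebra_simps)
  then show "\<iota> (p ^ n) * \<Delta> * z \<in> (\<lambda>x. \<iota> a * x) ` \<Lambda>"
    using assms \<open>x \<in> \<Lambda>\<close> by (auto simp: stable_def)
qed

lemma stable_homothety_invariant:
  assumes "homothety_class \<iota> \<Lambda> = homothety_class \<iota> \<Lambda>'"
  shows "stable n \<Lambda> \<longleftrightarrow> stable n \<Lambda>'"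
proof -
  obtain a where "\<Lambda> = (\<lambda>x. \<iota> a * x) ` \<Lambda>'"
    using homothety_class_eqD[OF assms] by blast
  moreover obtain b where "\<Lambda>' = (\<lambda>x. \<iota> b * x) ` \<Lambda>"
    using homothety_class_eqD[OF assms [symmetric]] by blast
  ultimately show ?thesis
    using stable_scale[of n \<Lambda> b] stable_scale[of n \<Lambda>' a] by metis
qed

lemma stable_Suc:
  assumes "free_rank_2 val \<iota> \<Lambda>" "stable n \<Lambda>"
  shows "stable (Suc n) \<Lambda>"
proof -
  obtain b c where \<Lambda>: "\<Lambda> = lattice b c"
    using assms(1) by (auto simp: free_rank_2_iff)
  have "\<iota> p * x + \<iota> 0 * x \<in> \<Lambda>" if "x \<in> \<Lambda>" for x
    using that unfolding \<Lambda> by (intro lattice_linear p_in_val_ring) auto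
  then have "\<iota> p * (\<iota> (p ^ n) * \<Delta> * x) \<in> \<Lambda>" if "x \<in> \<Lambda>" for x
    using assms(2) that by (auto simp: stable_def)
  then show ?thesis
    by (simp add: stable_def \<iota>_mult mult.assoc)
qed

definition level_le :: "nat \<Rightarrow> 'l set set set" where
  "level_le n = {homothety_class \<iota> \<Lambda> |\<Lambda>. free_rank_2 val \<iota> \<Lambda> \<and> stable n \<Lambda>}"

lemma level_le_iff:
  "free_rank_2 val \<iota> \<Lambda> \<Longrightarrow> homothety_class \<iota> \<Lambda> \<in> level_le n \<longleftrightarrow> stable n \<Lambda>"
  unfolding level_le_def using stable_homothety_invariant by blast

lemma level_le_Suc: "v \<in> level_le n \<Longrightarrow> v \<in> level_le (Suc n)"
  unfolding level_le_def using stable_Suc by blast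

text \<open>Forward, the rank condition makes the generator invertible, so the level is exactly
  \<open>n\<close>. Backward, a generator exists in L and only has to be scaled into the order. The
  disjunct \<open>n = 0\<close> is there because \<open>n - 1\<close> truncates at zero.\<close>

lemma principal_class_iff:
  assumes "v \<in> tree_vertices val \<iota>"
  shows "(\<exists>I. principal_ideal_of (order_n n) I \<and> free_rank_2 val \<iota> I \<and> v = homothety_class \<iota> I)
    \<longleftrightarrow> v \<in> level_le n \<and> (n = 0 \<or> v \<notin> level_le (n - 1))"
proof
  assume "\<exists>I. principal_ideal_of (order_n n) I \<and> free_rank_2 val \<iota> I \<and> v = homothety_class \<iota> I"
  then obtain a where a: "free_rank_2 val \<iota> ((\<lambda>y. a * y) ` order_n n)"
      "v = homothety_class \<iota> ((\<lambda>y. a * y) ` order_n n)"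
    by (auto simp: principal_ideal_of_def)
  then obtain a' where "a * a' = 1"
    using principal_free_iff_unit by blast
  then show "v \<in> level_le n \<and> (n = 0 \<or> v \<notin> level_le (n - 1))"
    using a by (auto simp: level_le_iff principal_stable_iff)
next
  assume v: "v \<in> level_le n \<and> (n = 0 \<or> v \<notin> level_le (n - 1))"
  then obtain \<Lambda> where \<Lambda>: "free_rank_2 val \<iota> \<Lambda>" "stable n \<Lambda>" "v = homothety_class \<iota> \<Lambda>"
    by (auto simp: level_le_def)
  then have "n = 0 \<or> \<not> stable (n - 1) \<Lambda>"
    using v level_le_iff by blast
  then obtain x where x: "\<Lambda> = (\<lambda>y. x * y) ` order_n n"
    using stable_imp_principal \<Lambda> by blast
  then obtain x' where x': "x * x' = 1"
    using \<Lambda>(1) principal_free_iff_unit by blast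
  obtain a b where ab: "x = \<iota> a + \<iota> b * \<Delta>"
    using coords_exist by blast
  obtain k where k: "p ^ k * a \<in> val_ring val" "p ^ k * b \<in> val_ring val"
    using clear_denominators by blast
  \<comment> \<open>\<open>p ^ k\<close> clears the denominators of both coordinates; the extra
    \<open>p ^ n\<close> makes the \<Delta>-coordinate divisible by \<open>p ^ n\<close>, as
    membership in \<open>order_n n\<close> demands.\<close>
  define c where "c = p ^ (k + n)"
  have "c \<noteq> 0"
    using uniformizer_K by (simp add: c_def)
  have "\<iota> c * x = \<iota> (p ^ n * (p ^ k * a)) + \<iota> (p ^ k * b * p ^ n) * \<Delta>"
    by (simp add: ab c_def \<iota>_hom power_add algebra_simps)
  then have "\<iota> c * x \<in> order_n n"
    using k by (simp only: order_n_iff) (auto intro: val_ring_mult p_in_val_ring)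
  moreover have "\<iota> c * x * (\<iota> (inverse c) * x') = \<iota> c * \<iota> (inverse c) * (x * x')"
    by (simp add: algebra_simps)
  then have "\<iota> c * x * (\<iota> (inverse c) * x') = 1"
    using x' \<open>c \<noteq> 0\<close> by (simp add: \<iota>_inverse)
  then have "free_rank_2 val \<iota> ((\<lambda>y. \<iota> c * x * y) ` order_n n)"
    using principal_free_iff_unit by blast
  moreover have "(\<lambda>y. \<iota> c * x * y) ` order_n n = (\<lambda>y. \<iota> c * y) ` \<Lambda>"
    by (simp add: x image_image mult.assoc)
  then have "v = homothety_class \<iota> ((\<lambda>y. \<iota> c * x * y) ` order_n n)"
    using \<Lambda>(3) homothety_class_scale[OF \<open>c \<noteq> 0\<close>] by simp
  ultimately show
    "\<exists>I. principal_ideal_of (order_n n) I \<and> free_rank_2 val \<iota> I \<and> v = homothety_class \<iota> I"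
    unfolding principal_ideal_of_def by blast
qed

section \<open>Neighbourhoods of the basin as level sets\<close>

lemma tree_setdist_le_1_iff:
  "tree_setdist val p \<iota> v S \<le> 1 \<longleftrightarrow> (\<exists>w\<in>S. v = w \<or> tree_adj val p \<iota> v w)"
proof
  assume "tree_setdist val p \<iota> v S \<le> 1"
  \<comment> \<open>A strict upper bound on an infimum yields a member satisfying the same bound,
    here a walk of length 0 or 1.\<close>
  then have "tree_setdist val p \<iota> v S < 2"
    by (rule order.strict_trans1) (simp add: one_enat_def numeral_eq_enat)
  then obtain w k where wk: "w \<in> S" "(tree_adj val p \<iota> ^^ k) v w" "enat k < 2"
    unfolding tree_setdist_def tree_dist_def by (auto simp: INF_less_iff)
  then have "k = 0 \<or> k = 1"
    by (auto simp: numeral_eq_enat)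
  then have "v = w \<or> tree_adj val p \<iota> v w"
    using wk(2) by (elim disjE) (simp_all add: eq_OO)
  then show "\<exists>w\<in>S. v = w \<or> tree_adj val p \<iota> v w"
    using wk(1) by (rule bexI)
next
  assume "\<exists>w\<in>S. v = w \<or> tree_adj val p \<iota> v w"
  then obtain w where w: "w \<in> S" "v = w \<or> tree_adj val p \<iota> v w" ..
  then obtain k where k: "(tree_adj val p \<iota> ^^ k) v w" "k \<le> 1"
    by (metis le_numeral_extra(4) relpowp_0_I relpowp_1 zero_le_one)
  have "tree_setdist val p \<iota> v S \<le> tree_dist val p \<iota> v w"
    unfolding tree_setdist_def using w(1) by (rule INF_lower)
  also have "\<dots> \<le> enat k"
    unfolding tree_dist_def using k(1) by (intro INF_lower) simp
  also have "\<dots> \<le> 1"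
    using k(2) by (simp add: one_enat_def)
  finally show "tree_setdist val p \<iota> v S \<le> 1" .
qed

text \<open>For \<open>x\<close> in \<open>\<Lambda>\<close> the multiple
  \<open>\<iota> p * x\<close> falls into the smaller lattice, which is stable under
  \<open>\<iota> (p ^ n) * \<Delta>\<close>; the product is back in \<open>\<Lambda>\<close>, and
  the extra factor \<open>p\<close> accounts for the one level lost.\<close>

lemma adj_level:
  assumes "tree_adj val p \<iota> v w" "w \<in> level_le n"
  shows "v \<in> level_le (Suc n)"
proof -
  obtain \<Lambda> \<Lambda>' where \<Lambda>: "\<Lambda> \<in> v" "\<Lambda>' \<in> w" "(\<lambda>x. \<iota> p * x) ` \<Lambda> \<subseteq> \<Lambda>'" "\<Lambda>' \<subseteq> \<Lambda>"
    using assms(1) unfolding tree_adj_def by blast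
  obtain M where M: "v = homothety_class \<iota> M" "free_rank_2 val \<iota> M"
    using assms(1) unfolding tree_adj_def tree_vertices_def by blast
  obtain M' where M': "w = homothety_class \<iota> M'" "stable n M'"
    using assms(2) unfolding level_le_def by blast
  have "stable n \<Lambda>'"
    using \<Lambda>(2) M' stable_scale by (auto simp: homothety_class_def)
  have "\<iota> (p ^ Suc n) * \<Delta> * x \<in> \<Lambda>" if "x \<in> \<Lambda>" for x
  proof -
    have "\<iota> p * x \<in> \<Lambda>'"
      using \<Lambda> that by blast
    then have "\<iota> (p ^ n) * \<Delta> * (\<iota> p * x) \<in> \<Lambda>"
      using \<open>stable n \<Lambda>'\<close> \<Lambda> by (auto simp: stable_def)
    then show ?thesis
      by (simp add: \<iota>_mult algebra_simps)
  qed
  then have "stable (Suc n) \<Lambda>"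
    by (simp add: stable_def)
  moreover obtain a where "a \<noteq> 0" "\<Lambda> = (\<lambda>x. \<iota> a * x) ` M"
    using \<Lambda>(1) M by (auto simp: homothety_class_def)
  then have "homothety_class \<iota> \<Lambda> = homothety_class \<iota> M"
    using homothety_class_scale by simp
  ultimately show ?thesis
    using M level_le_iff stable_homothety_invariant by blast
qed

lemma level_Suc_neighbour:
  assumes "v \<in> level_le (Suc n)" "v \<notin> level_le n"
  shows "\<exists>w\<in>level_le n. tree_adj val p \<iota> v w"
proof -
  obtain \<Lambda> where \<Lambda>: "free_rank_2 val \<iota> \<Lambda>" "stable (Suc n) \<Lambda>" "v = homothety_class \<iota> \<Lambda>"
    using assms(1) by (auto simp: level_le_def)
  then have "\<not> stable n \<Lambda>"
    using assms(2) level_le_iff by blast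
  then obtain x where x: "\<Lambda> = (\<lambda>y. x * y) ` order_n (Suc n)"
    using stable_imp_principal[of \<Lambda> "Suc n"] \<Lambda> by auto
  then obtain x' where x': "x * x' = 1"
    using \<Lambda>(1) principal_free_iff_unit by blast
  then have cancel: "x * y = x * z \<longleftrightarrow> y = z" for y z
    by (metis mult.commute mult.left_commute mult_1)
  define M where "M = (\<lambda>y. x * y) ` order_n n"
  \<comment> \<open>Adjacency asks for a sublattice of \<open>\<Lambda>\<close>, so the class of
    \<open>M\<close> is represented by \<open>p\<close> times \<open>M\<close>: this rests on p
    O_{n+1} < p O_n < O_{n+1}. Strictness is witnessed by \<open>\<iota> (p ^ n) * \<Delta>\<close>,
    missing from \<open>order_n (Suc n)\<close>, and by 1, missing from p O_n.\<close>
  define M' where "M' = (\<lambda>y. \<iota> p * y) ` M"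
  have M: "free_rank_2 val \<iota> M" "stable n M"
    unfolding M_def using x' principal_free_iff_unit principal_stable_iff by blast+
  have w: "homothety_class \<iota> M' = homothety_class \<iota> M"
    unfolding M'_def using homothety_class_scale uniformizer_K by blast
  have order_le: "order_n (Suc n) \<subset> order_n n"
  proof
    show "order_n (Suc n) \<subseteq> order_n n"
    proof
      fix z
      assume "z \<in> order_n (Suc n)"
      moreover obtain a b where "z = \<iota> a + \<iota> b * \<Delta>"
        using coords_exist by blast
      ultimately show "z \<in> order_n n"
        by (auto simp: order_n_iff mult.assoc [symmetric] intro: val_ring_mult p_in_val_ring)
    qed
    have "\<iota> 0 + \<iota> (p ^ n) * \<Delta> \<in> order_n n"
      unfolding order_n_iff by (auto intro: bexI[of _ 1])
    moreover have "\<iota> 0 + \<iota> (p ^ n) * \<Delta> \<notin> order_n (Suc n)"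
    proof
      assume "\<iota> 0 + \<iota> (p ^ n) * \<Delta> \<in> order_n (Suc n)"
      then obtain s where "s \<in> val_ring val" "p ^ n = s * p ^ Suc n"
        unfolding order_n_iff by blast
      then have "s = inverse p"
        using uniformizer_K by (simp add: field_simps)
      then show False
        using \<open>s \<in> val_ring val\<close> inverse_p_notin_val_ring by simp
    qed
    ultimately show "order_n (Suc n) \<noteq> order_n n"
      by blast
  qed
  have p_order: "(\<lambda>y. \<iota> p * y) ` order_n n \<subset> order_n (Suc n)"
  proof
    have mult: "\<iota> p * (\<iota> a + \<iota> b * \<Delta>) = \<iota> (p * a) + \<iota> (p * b) * \<Delta>" for a b
      by (simp add: \<iota>_mult algebra_simps)
    show "(\<lambda>y. \<iota> p * y) ` order_n n \<subseteq> order_n (Suc n)"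
    proof
      fix z
      assume "z \<in> (\<lambda>y. \<iota> p * y) ` order_n n"
      then obtain a b where ab: "z = \<iota> p * (\<iota> a + \<iota> b * \<Delta>)" "\<iota> a + \<iota> b * \<Delta> \<in> order_n n"
        using coords_exist by (metis imageE)
      then show "z \<in> order_n (Suc n)"
        unfolding ab(1) mult order_n_iff by (auto intro: val_ring_mult p_in_val_ring)
    qed
    have "\<iota> 1 + \<iota> 0 * \<Delta> \<in> order_n (Suc n)"
      unfolding order_n_iff by (auto intro: bexI[of _ 0])
    moreover have "\<iota> 1 + \<iota> 0 * \<Delta> \<notin> (\<lambda>y. \<iota> p * y) ` order_n n"
    proof
      assume "\<iota> 1 + \<iota> 0 * \<Delta> \<in> (\<lambda>y. \<iota> p * y) ` order_n n"
      then obtain a b where ab: "\<iota> 1 + \<iota> 0 * \<Delta> = \<iota> (p * a) + \<iota> (p * b) * \<Delta>"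
          "\<iota> a + \<iota> b * \<Delta> \<in> order_n n"
        using coords_exist mult by (metis imageE)
      then have "p * a = 1" "a \<in> val_ring val"
        using coords_unique(1)[OF ab(1)] by (auto simp: order_n_iff)
      then show False
        using inverse_p_notin_val_ring by (metis inverse_unique)
    qed
    ultimately show "(\<lambda>y. \<iota> p * y) ` order_n n \<noteq> order_n (Suc n)"
      by blast
  qed
  have scale: "(\<lambda>y. a * y) ` A \<subset> (\<lambda>y. a * y) ` B"
    if "A \<subset> B" "inj (\<lambda>y. a * y)" for a and A B :: "'l set"
    using that by (simp add: inj_image_subset_iff psubset_eq inj_image_eq_iff)
  have inj: "inj (\<lambda>y. x * y)" "inj (\<lambda>y. \<iota> p * y)"
    using cancel \<iota>_cancel uniformizer_K by (auto intro: injI)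
  have "M' = (\<lambda>y. x * y) ` (\<lambda>y. \<iota> p * y) ` order_n n"
    by (simp add: M'_def M_def image_image mult.left_commute)
  then have "M' \<subset> \<Lambda>"
    unfolding x using scale[OF p_order inj(1)] by simp
  moreover have "(\<lambda>y. \<iota> p * y) ` \<Lambda> \<subset> M'"
    unfolding M'_def M_def x by (intro scale order_le inj)
  moreover have "homothety_class \<iota> M \<in> tree_vertices val \<iota>" "v \<in> tree_vertices val \<iota>"
    using M \<Lambda> by (auto simp: tree_vertices_def)
  moreover have "\<Lambda> \<in> v" "M' \<in> homothety_class \<iota> M"
    using homothety_class_self \<Lambda>(3) w by auto
  ultimately have "tree_adj val p \<iota> v (homothety_class \<iota> M)"
    unfolding tree_adj_def by (intro conjI bexI[of _ \<Lambda>] bexI[of _ M'])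
  moreover have "homothety_class \<iota> M \<in> level_le n"
    using M level_le_iff by blast
  ultimately show ?thesis ..
qed

lemma basin_nbhd_eq_level_le: "basin_nbhd val p \<iota> (level_le 0) n = level_le n"
proof (induction n)
  case (Suc n)
  have "v \<in> level_le (Suc n) \<longleftrightarrow>
      v \<in> tree_vertices val \<iota> \<and> (\<exists>w\<in>level_le n. v = w \<or> tree_adj val p \<iota> v w)" for v
  proof
    assume v: "v \<in> level_le (Suc n)"
    then have "v \<in> tree_vertices val \<iota>"
      by (auto simp: level_le_def tree_vertices_def)
    then show "v \<in> tree_vertices val \<iota> \<and> (\<exists>w\<in>level_le n. v = w \<or> tree_adj val p \<iota> v w)"
      using level_Suc_neighbour[OF v] by blast
  qed (auto intro: level_le_Suc adj_level)
  then show ?case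
    by (auto simp: Suc.IH tree_setdist_le_1_iff)
qed simp

section \<open>The basin\<close>

abbreviation O_L :: "'l set" where
  "O_L \<equiv> integral_closure val \<iota>"

lemma O_L_mult: "x \<in> O_L \<Longrightarrow> y \<in> O_L \<Longrightarrow> x * y \<in> O_L"
  unfolding integral_closure_eq_order by (rule quadratic_order_mult)

lemma O_L_1: "1 \<in> O_L"
  using \<iota>_val_ring_integral[of 1] by (simp add: \<iota>_one)

lemma O_L_power: "x \<in> O_L \<Longrightarrow> x ^ k \<in> O_L"
  by (induction k) (simp_all add: O_L_1 O_L_mult)

lemma O_L_linear:
  assumes "x \<in> O_L" "y \<in> O_L" "r \<in> val_ring val" "s \<in> val_ring val"
  shows "\<iota> r * x + \<iota> s * y \<in> O_L"
proof -
  have "O_L = lattice 1 \<Delta>"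
    using principal_eq_lattice[of 1 0] by (simp add: integral_closure_eq_order \<iota>_one)
  then show ?thesis
    using assms lattice_linear by simp
qed

lemma O_L_add: "x \<in> O_L \<Longrightarrow> y \<in> O_L \<Longrightarrow> x + y \<in> O_L"
  using O_L_linear[of x y 1 1] by (simp add: \<iota>_one)

lemma O_L_uminus: "x \<in> O_L \<Longrightarrow> - x \<in> O_L"
  using O_L_linear[of x x "- 1" 0] by (simp add: \<iota>_hom val_ge_uminus)

lemma level_0_eq:
  "level_le 0 = {homothety_class \<iota> ((\<lambda>y. x * y) ` O_L) |x. \<exists>x'. x * x' = 1}"
proof -
  have "v \<in> level_le 0 \<longleftrightarrow> (\<exists>x x'. v = homothety_class \<iota> ((\<lambda>y. x * y) ` O_L) \<and> x * x' = 1)" for v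
  proof
    assume "v \<in> level_le 0"
    then obtain \<Lambda> where \<Lambda>: "free_rank_2 val \<iota> \<Lambda>" "stable 0 \<Lambda>" "v = homothety_class \<iota> \<Lambda>"
      by (auto simp: level_le_def)
    then obtain x where "\<Lambda> = (\<lambda>y. x * y) ` O_L"
      using stable_imp_principal[of \<Lambda> 0] by (auto simp: integral_closure_eq_order)
    then show "\<exists>x x'. v = homothety_class \<iota> ((\<lambda>y. x * y) ` O_L) \<and> x * x' = 1"
      using \<Lambda> principal_free_iff_unit by (metis integral_closure_eq_order)
  next
    assume "\<exists>x x'. v = homothety_class \<iota> ((\<lambda>y. x * y) ` O_L) \<and> x * x' = 1"
    then obtain x x' where x: "v = homothety_class \<iota> ((\<lambda>y. x * y) ` order_n 0)" "x * x' = 1"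
      by (auto simp: integral_closure_eq_order)
    then have "free_rank_2 val \<iota> ((\<lambda>y. x * y) ` order_n 0)" "stable 0 ((\<lambda>y. x * y) ` order_n 0)"
      using principal_free_iff_unit principal_stable_iff by blast+
    then show "v \<in> level_le 0"
      using x(1) level_le_iff by blast
  qed
  then show ?thesis
    by blast
qed

text \<open>Units of O_L preserve O_L, and scalars of K preserve classes. Both the split and the
  field case normalize a generator \<open>x\<close> by factoring it in this way.\<close>

lemma associated_class_eq:
  assumes "c \<noteq> 0" "u \<in> O_L" "u' \<in> O_L" "u * u' = 1"
  shows "homothety_class \<iota> ((\<lambda>y. \<iota> c * z * u * y) ` O_L) = homothety_class \<iota> ((\<lambda>y. z * y) ` O_L)"
proof -
  have "y = u * (u' * y)" for y
    using assms(4) by (simp add: mult.assoc [symmetric])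
  then have "(\<lambda>y. u * y) ` O_L = O_L"
    using assms(2,3) by (auto intro: O_L_mult image_eqI)
  moreover have "(\<lambda>y. \<iota> c * z * u * y) ` O_L = (\<lambda>y. \<iota> c * y) ` (\<lambda>y. z * y) ` (\<lambda>y. u * y) ` O_L"
    by (simp add: image_image mult.assoc)
  ultimately show ?thesis
    using homothety_class_scale[OF assms(1)] by simp
qed

section \<open>The split basin\<close>

lemma val_power_int: "val (p powi m) = m"
  using uniformizer_K by (cases "m \<ge> 0") (auto simp: power_int_def val_power val_inverse)

text \<open>A polynomial relation in L holds in each component, and the valuation ring is integrally
  closed. Conversely, an element with components \<open>a\<close>, \<open>b\<close> is a root of (X
  - a)(X - b).\<close>

lemma splitting_O_L:
  assumes "splitting_iso \<iota> \<phi>"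
  shows "O_L = \<phi> -` (val_ring val \<times> val_ring val)"
proof -
  have bij: "bij \<phi>" and add: "\<And>x y. \<phi> (x + y) = (fst (\<phi> x) + fst (\<phi> y), snd (\<phi> x) + snd (\<phi> y))"
    and mult: "\<And>x y. \<phi> (x * y) = (fst (\<phi> x) * fst (\<phi> y), snd (\<phi> x) * snd (\<phi> y))"
    and \<phi>_\<iota>: "\<And>a. \<phi> (\<iota> a) = (a, a)"
    using assms by (auto simp: splitting_iso_def)
  have \<phi>_0: "\<phi> 0 = (0, 0)"
    using \<phi>_\<iota>[of 0] by simp
  have poly: "\<phi> (poly (map_poly \<iota> f) x) = (poly f (fst (\<phi> x)), poly f (snd (\<phi> x)))" for f x
  proof (induction f)
    case (pCons a f)
    then show ?case
      by (simp only: poly_map_\<iota>_pCons add mult \<phi>_\<iota>) simp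
  qed (simp add: \<phi>_0)
  show ?thesis
  proof (intro equalityI subsetI)
    fix x
    assume "x \<in> O_L"
    then obtain f where f: "lead_coeff f = 1" "\<And>i. coeff f i \<in> val_ring val"
        "poly (map_poly \<iota> f) x = 0"
      by (auto simp: integral_closure_def)
    then have "poly f (fst (\<phi> x)) = 0" "poly f (snd (\<phi> x)) = 0"
      using poly[of f x] \<phi>_0 by auto
    then show "x \<in> \<phi> -` (val_ring val \<times> val_ring val)"
      using integral_over_val_ring[OF f(1,2)] by (simp add: mem_Times_iff)
  next
    fix x
    assume x: "x \<in> \<phi> -` (val_ring val \<times> val_ring val)"
    obtain a b where ab: "\<phi> x = (a, b)"
      by fastforce
    have "\<phi> (x * x) = \<phi> (\<iota> (a + b) * x + \<iota> (- (a * b)))"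
      by (simp add: add mult \<phi>_\<iota> ab algebra_simps)
    then have "x * x = \<iota> (a + b) * x - \<iota> (a * b)"
      using bij by (simp add: bij_def inj_eq \<iota>_uminus)
    then show "x \<in> O_L"
      using x ab by (intro integral_quadratic[of x "a + b" "a * b"]) (auto intro: val_ring_closed)
  qed
qed

text \<open>An invertible element with components \<open>a\<close>, \<open>b\<close> is the scalar
  \<open>a\<close> times \<open>\<psi> 1 (p powi m)\<close> times a unit of O_L, where
  \<open>m = val b - val a\<close>; so \<open>m\<close> determines its class.\<close>

lemma split_basin:
  assumes "splitting_iso \<iota> \<phi>"
  shows "{homothety_class \<iota> (\<phi> -` (val_ring val \<times> (\<lambda>x. p powi m * x) ` val_ring val)) |m. True}
    = level_le 0"
proof -
  have bij: "bij \<phi>"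
    and mult: "\<And>x y. \<phi> (x * y) = (fst (\<phi> x) * fst (\<phi> y), snd (\<phi> x) * snd (\<phi> y))"
    and \<phi>_\<iota>: "\<And>a. \<phi> (\<iota> a) = (a, a)"
    using assms by (auto simp: splitting_iso_def)
  have \<phi>_eq: "x = y \<longleftrightarrow> \<phi> x = \<phi> y" for x y
    using bij by (simp add: bij_def inj_eq)
  have \<phi>_1: "\<phi> 1 = (1, 1)"
    using \<phi>_\<iota>[of 1] by (simp add: \<iota>_one)
  define \<psi> where "\<psi> a b = inv \<phi> (a, b)" for a b
  have \<phi>_\<psi>: "\<phi> (\<psi> a b) = (a, b)" for a b
    using bij by (simp add: \<psi>_def bij_def surj_f_inv_f)
  have O_L_iff: "x \<in> O_L \<longleftrightarrow> fst (\<phi> x) \<in> val_ring val \<and> snd (\<phi> x) \<in> val_ring val" for x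
    using splitting_O_L[OF assms] by (simp add: mem_Times_iff)
  have pm: "p powi m \<noteq> 0" for m
    using uniformizer_K by simp
  have eq: "\<phi> -` (val_ring val \<times> (\<lambda>x. p powi m * x) ` val_ring val) =
      (\<lambda>y. \<psi> 1 (p powi m) * y) ` O_L" for m
  proof (intro equalityI subsetI)
    fix y
    assume "y \<in> \<phi> -` (val_ring val \<times> (\<lambda>x. p powi m * x) ` val_ring val)"
    then obtain a b where "\<phi> y = (a, p powi m * b)" "a \<in> val_ring val" "b \<in> val_ring val"
      by auto
    then have "y = \<psi> 1 (p powi m) * \<psi> a b" "\<psi> a b \<in> O_L"
      by (simp_all add: \<phi>_eq[of y] O_L_iff mult \<phi>_\<psi>)
    then show "y \<in> (\<lambda>y. \<psi> 1 (p powi m) * y) ` O_L"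
      by blast
  qed (auto simp: O_L_iff mult \<phi>_\<psi> mem_Times_iff)
  have "v \<in> level_le 0 \<longleftrightarrow> (\<exists>m. v = homothety_class \<iota> ((\<lambda>y. \<psi> 1 (p powi m) * y) ` O_L))" for v
  proof
    assume "v \<in> level_le 0"
    then obtain x x' where x: "v = homothety_class \<iota> ((\<lambda>y. x * y) ` O_L)" "x * x' = 1"
      unfolding level_0_eq by blast
    define a b where "a = fst (\<phi> x)" and "b = snd (\<phi> x)"
    have "(a * fst (\<phi> x'), b * snd (\<phi> x')) = (1, 1)"
      using x(2) mult[of x x'] \<phi>_1 by (simp add: a_def b_def)
    then have nz: "a \<noteq> 0" "b \<noteq> 0"
      by auto
    define m where "m = val b - val a"
    define c where "c = b * inverse a * inverse (p powi m)"
    have c: "c \<noteq> 0" "val c = 0"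
      using nz pm[of m] unfolding c_def
      by (simp_all add: val_mult val_inverse val_power_int m_def del: power_int_eq_0_iff)
    have "x = \<iota> a * \<psi> 1 (p powi m) * \<psi> 1 c"
      using nz pm[of m] by (simp add: \<phi>_eq[of x] mult \<phi>_\<psi> \<phi>_\<iota> prod_eq_iff a_def [symmetric]
          b_def [symmetric]) (simp add: c_def field_simps)
    moreover have "\<psi> 1 c \<in> O_L" "\<psi> 1 (inverse c) \<in> O_L" "\<psi> 1 c * \<psi> 1 (inverse c) = 1"
      using c by (simp_all add: O_L_iff \<phi>_\<psi> \<phi>_eq[of _ 1] mult \<phi>_1)
        (simp_all add: val_ge_def val_inverse)
    ultimately have "v = homothety_class \<iota> ((\<lambda>y. \<psi> 1 (p powi m) * y) ` O_L)"
      unfolding x(1) using associated_class_eq[of a "\<psi> 1 c" "\<psi> 1 (inverse c)"] nz by simp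
    then show "\<exists>m. v = homothety_class \<iota> ((\<lambda>y. \<psi> 1 (p powi m) * y) ` O_L)" ..
  next
    assume "\<exists>m. v = homothety_class \<iota> ((\<lambda>y. \<psi> 1 (p powi m) * y) ` O_L)"
    then obtain m where m: "v = homothety_class \<iota> ((\<lambda>y. \<psi> 1 (p powi m) * y) ` O_L)" ..
    have "\<psi> 1 (p powi m) * \<psi> 1 (inverse (p powi m)) = 1"
      using pm by (simp add: \<phi>_eq[of _ 1] mult \<phi>_\<psi> \<phi>_1)
    then show "v \<in> level_le 0"
      unfolding level_0_eq m by blast
  qed
  then show ?thesis
    unfolding eq by blast
qed

section \<open>Field extensions: powers of a uniformizer and the ramification index\<close>

lemma all_powers_divide_imp_zero:
  assumes "\<And>k. z \<in> (\<lambda>y. \<iota> (p ^ k) * y) ` O_L"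
  shows "z = 0"
proof -
  obtain a b where z: "z = \<iota> a + \<iota> b * \<Delta>"
    using coords_exist by blast
  have *: "\<exists>a'\<in>val_ring val. \<exists>b'\<in>val_ring val. a = p ^ k * a' \<and> b = p ^ k * b'" for k
  proof -
    obtain y where y: "y \<in> O_L" "z = \<iota> (p ^ k) * y"
      using assms by blast
    obtain a' b' where y': "y = \<iota> a' + \<iota> b' * \<Delta>"
      using coords_exist by blast
    then have "\<iota> a + \<iota> b * \<Delta> = \<iota> (p ^ k * a') + \<iota> (p ^ k * b') * \<Delta>"
      using y(2) z by (simp add: \<iota>_mult algebra_simps)
    then have "a = p ^ k * a'" "b = p ^ k * b'"
      by (rule coords_unique)+
    then show ?thesis
      using y(1) unfolding y' integral_closure_eq_order order_n_iff by auto
  qed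
  have "c = 0" if "\<And>k. \<exists>c'\<in>val_ring val. c = p ^ k * c'" for c
  proof (rule ccontr)
    assume "c \<noteq> 0"
    \<comment> \<open>The exponent exceeds \<open>val c\<close>, although the cofactor
      \<open>c'\<close> is integral.\<close>
    obtain c' where c': "c' \<in> val_ring val" "c = p ^ Suc (nat \<bar>val c\<bar>) * c'"
      using \<open>\<And>k. \<exists>c'\<in>val_ring val. c = p ^ k * c'\<close> by blast
    then have "c' \<noteq> 0"
      using \<open>c \<noteq> 0\<close> by auto
    then have "val c = int (Suc (nat \<bar>val c\<bar>)) + val c'" "0 \<le> val c'"
      using c' uniformizer_K val_mult[of "p ^ Suc (nat \<bar>val c\<bar>)" c']
        val_power[of p "Suc (nat \<bar>val c\<bar>)"]
      by (auto simp: val_ge_def simp del: power_Suc)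
    then show False
      by simp
  qed
  then have "a = 0" "b = 0"
    using * by blast+
  then show ?thesis
    by (simp add: z)
qed

context
  fixes \<pi> :: 'l and e :: nat
  assumes unif: "uniformizer_L val \<iota> \<pi>"
    and ram: "(\<lambda>x. \<iota> p * x) ` O_L = (\<lambda>x. \<pi> ^ e * x) ` O_L"
    and e_pos: "e > 0"
begin

lemma nonunit_iff: "x \<in> O_L \<Longrightarrow> (\<nexists>y. y \<in> O_L \<and> x * y = 1) \<longleftrightarrow> x \<in> (\<lambda>y. \<pi> * y) ` O_L"
  using unif unfolding uniformizer_L_def by blast

text \<open>Equal principal ideals give two cofactors; since \<open>\<iota> p\<close> is invertible
  in L it can be cancelled, which makes them mutually inverse.\<close>

lemma \<pi>_power_e: "\<exists>w w'. w \<in> O_L \<and> w' \<in> O_L \<and> w * w' = 1 \<and> \<pi> ^ e = \<iota> p * w \<and> \<iota> p = \<pi> ^ e * w'"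
proof -
  obtain w where w: "w \<in> O_L" "\<pi> ^ e = \<iota> p * w"
    using ram O_L_1 by (metis (no_types, lifting) imageE imageI mult.right_neutral)
  obtain w' where w': "w' \<in> O_L" "\<iota> p = \<pi> ^ e * w'"
    using ram O_L_1 by (metis (no_types, lifting) imageE imageI mult.right_neutral)
  have "\<iota> p * (w * w') = \<iota> p * 1"
    using w(2) w'(2) by (metis mult.assoc mult.right_neutral)
  then show ?thesis
    using w w' \<iota>_cancel uniformizer_K by blast
qed

lemma \<pi>_unit: "\<exists>\<pi>'. \<pi> * \<pi>' = 1"
proof -
  obtain w' where "\<iota> p = \<pi> ^ e * w'"
    using \<pi>_power_e by blast
  then have "\<pi> * (\<pi> ^ (e - 1) * w' * \<iota> (inverse p)) = \<iota> p * \<iota> (inverse p)"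
    using e_pos by (cases e) (simp_all add: mult.assoc)
  then show ?thesis
    using uniformizer_K by (auto simp: \<iota>_inverse)
qed

lemma \<pi>_cancel: "\<pi> * x = \<pi> * y \<Longrightarrow> x = y"
  using \<pi>_unit by (metis mult.commute mult.left_commute mult_1)

text \<open>A nonunit of O_L is a multiple of \<open>\<pi>\<close>. If splitting off factors
  \<open>\<pi>\<close> never reached a unit, \<open>z\<close> would be divisible by all powers of
  \<open>\<pi>\<close>, hence of \<open>p\<close>, and would vanish.\<close>

lemma \<pi>_factorization:
  assumes "z \<in> O_L" "z \<noteq> 0"
  shows "\<exists>k u u'. z = \<pi> ^ k * u \<and> u \<in> O_L \<and> u' \<in> O_L \<and> u * u' = 1"
proof (rule ccontr)
  assume *: "\<nexists>k u u'. z = \<pi> ^ k * u \<and> u \<in> O_L \<and> u' \<in> O_L \<and> u * u' = 1"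
  have div: "\<exists>y\<in>O_L. z = \<pi> ^ k * y" for k
  proof (induction k)
    case 0
    then show ?case
      using assms by simp
  next
    case (Suc k)
    then obtain y where y: "y \<in> O_L" "z = \<pi> ^ k * y"
      by blast
    then have "\<nexists>y'. y' \<in> O_L \<and> y * y' = 1"
      using * by blast
    then obtain y' where "y' \<in> O_L" "y = \<pi> * y'"
      using nonunit_iff[OF y(1)] by blast
    then show ?case
      using y(2) by (auto simp: mult.assoc mult.left_commute)
  qed
  have "z \<in> (\<lambda>y. \<iota> (p ^ k) * y) ` O_L" for k
  proof -
    obtain w where w: "w \<in> O_L" "\<pi> ^ e = \<iota> p * w"
      using \<pi>_power_e by blast
    obtain y where y: "y \<in> O_L" "z = \<pi> ^ (e * k) * y"
      using div by blast
    have "z = \<iota> (p ^ k) * (w ^ k * y)"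
      by (simp add: y(2) power_mult w(2) power_mult_distrib \<iota>_power mult.assoc)
    then show ?thesis
      using O_L_mult[OF O_L_power[OF w(1)] y(1)] by blast
  qed
  then have "z = 0"
    by (rule all_powers_divide_imp_zero)
  then show False
    using assms(2) by simp
qed

text \<open>Up to a unit of O_L, \<open>\<pi> ^ e\<close> is the scalar \<open>p\<close>, so for the
  class of a power of \<open>\<pi>\<close> the exponent matters only modulo
  \<open>e\<close>.\<close>

lemma field_level_0_eq: "level_le 0 = {homothety_class \<iota> ((\<lambda>y. \<pi> ^ r * y) ` O_L) |r. r < e}"
proof -
  have "v \<in> level_le 0 \<longleftrightarrow> (\<exists>r<e. v = homothety_class \<iota> ((\<lambda>y. \<pi> ^ r * y) ` O_L))" for v
  proof
    assume "v \<in> level_le 0"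
    then obtain x x' where x: "v = homothety_class \<iota> ((\<lambda>y. x * y) ` O_L)" "x * x' = 1"
      unfolding level_0_eq by blast
    obtain j where j: "\<iota> (p ^ j) * x \<in> O_L"
      using integral_multiple by blast
    have pj: "p ^ j \<noteq> 0"
      using uniformizer_K by simp
    have "\<iota> (inverse (p ^ j)) * (\<iota> (p ^ j) * x) * x' = 1"
      using pj x(2) by (simp add: mult.assoc [symmetric] \<iota>_inverse)
    moreover have "(1::'l) \<noteq> 0"
      using one_independent[OF generator_not_scalar, of 1 0] by (auto simp: \<iota>_one)
    ultimately have "\<iota> (p ^ j) * x \<noteq> 0"
      by auto
    then obtain k u u' where u: "\<iota> (p ^ j) * x = \<pi> ^ k * u" "u \<in> O_L" "u' \<in> O_L" "u * u' = 1"
      using \<pi>_factorization[OF j] by blast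
    obtain w w' where w: "w \<in> O_L" "w' \<in> O_L" "w * w' = 1" "\<pi> ^ e = \<iota> p * w"
      using \<pi>_power_e by blast
    define q r where "q = k div e" and "r = k mod e"
    have "\<pi> ^ k = (\<pi> ^ e) ^ q * \<pi> ^ r"
      by (simp add: q_def r_def power_mult [symmetric] power_add [symmetric])
    then have "x = \<iota> (inverse (p ^ j)) * ((\<iota> p * w) ^ q * \<pi> ^ r * u)"
      using u(1) w(4) \<iota>_inverse(2)[OF pj] by (metis mult.assoc mult_1)
    then have "x = \<iota> (inverse (p ^ j) * p ^ q) * \<pi> ^ r * (w ^ q * u)"
      by (simp add: power_mult_distrib \<iota>_mult \<iota>_power mult.assoc mult.left_commute mult.commute)
    moreover have "w ^ q * u * (w' ^ q * u') = (w * w') ^ q * (u * u')"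
      by (simp add: power_mult_distrib mult.assoc mult.left_commute mult.commute)
    then have "w ^ q * u * (w' ^ q * u') = 1"
      using w u by simp
    moreover have "inverse (p ^ j) * p ^ q \<noteq> 0"
      using uniformizer_K by simp
    ultimately have "v = homothety_class \<iota> ((\<lambda>y. \<pi> ^ r * y) ` O_L)"
      unfolding x(1)
      using associated_class_eq[OF _ O_L_mult[OF O_L_power[OF w(1)] u(2)]
          O_L_mult[OF O_L_power[OF w(2)] u(3)]] by simp
    moreover have "r < e"
      using e_pos by (simp add: r_def)
    ultimately show "\<exists>r<e. v = homothety_class \<iota> ((\<lambda>y. \<pi> ^ r * y) ` O_L)"
      by blast
  next
    assume "\<exists>r<e. v = homothety_class \<iota> ((\<lambda>y. \<pi> ^ r * y) ` O_L)"
    then obtain r where "v = homothety_class \<iota> ((\<lambda>y. \<pi> ^ r * y) ` O_L)"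
      by blast
    moreover obtain \<pi>' where "\<pi> * \<pi>' = 1"
      using \<pi>_unit by blast
    then have "\<pi> ^ r * \<pi>' ^ r = 1"
      by (simp add: power_mult_distrib [symmetric])
    ultimately show "v \<in> level_le 0"
      unfolding level_0_eq by blast
  qed
  then show ?thesis
    by blast
qed

lemma \<pi>_integral: "\<pi> \<in> O_L"
proof -
  have "\<pi> * 1 \<in> (\<lambda>x. \<pi> * x) ` O_L"
    using O_L_1 by blast
  then show ?thesis
    using unif unfolding uniformizer_L_def by auto
qed

text \<open>
  For \<open>e \<ge> 3\<close> the terms of \<open>a + b \<pi> + c \<pi>\<^sup>2\<close> would have valuations distinct modulo \<open>e\<close>, making
  \<open>1, \<pi>, \<pi>\<^sup>2\<close> independent over \<open>K\<close>.
\<close>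

lemma ramification_index_le_2: "e \<le> 2"
proof (rule ccontr)
  assume "\<not> e \<le> 2"
  \<comment> \<open>An element of the valuation ring outside \<open>val_ge val 1\<close> is a unit
    there, hence in O_L, whereas multiples of \<open>\<pi>\<close> are nonunits.\<close>
  have div1: "a \<in> val_ge val 1" if "a \<in> val_ring val" "\<iota> a \<in> (\<lambda>y. \<pi> * y) ` O_L" for a
  proof (rule ccontr)
    assume "a \<notin> val_ge val 1"
    then have "inverse a \<in> val_ring val" "a \<noteq> 0"
      using that inverse_in_val_ring by auto
    then have "\<iota> (inverse a) \<in> O_L" "\<iota> a * \<iota> (inverse a) = 1"
      by (simp_all add: \<iota>_val_ring_integral \<iota>_inverse)
    then show False
      using nonunit_iff[OF \<iota>_val_ring_integral[OF that(1)]] that(2) by blast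
  qed
  \<comment> \<open>This is where \<open>e \<ge> 3\<close> enters: the cube of \<open>\<pi>\<close>
    divides \<open>p\<close>.\<close>
  have div3: "\<exists>z\<in>O_L. \<iota> a = \<pi> * (\<pi> * (\<pi> * z))" if "a \<in> val_ge val 1" for a
  proof -
    obtain w' where w': "w' \<in> O_L" "\<iota> p = \<pi> ^ e * w'"
      using \<pi>_power_e by blast
    have e: "e = Suc (Suc (Suc (e - 3)))"
      using \<open>\<not> e \<le> 2\<close> by simp
    have "\<iota> a = \<iota> p * \<iota> (inverse p * a)"
      using uniformizer_K by (simp add: \<iota>_mult mult.assoc [symmetric] \<iota>_inverse)
    also have "\<dots> = \<pi> * (\<pi> * (\<pi> * (\<pi> ^ (e - 3) * w' * \<iota> (inverse p * a))))"
      unfolding w'(2) by (subst e) (simp only: power_Suc mult.assoc)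
    finally show ?thesis
      using that w'(1) O_L_mult O_L_power \<pi>_integral \<iota>_val_ring_integral val_ge_1_eq by meson
  qed
  \<comment> \<open>Reading the relation modulo \<open>\<pi>\<close> and cancelling
    \<open>\<pi>\<close> forces \<open>p\<close> to divide \<open>a\<close>, then \<open>b\<close>,
    then \<open>c\<close>. Divisibility by the cube leaves a factor \<open>\<pi>\<close> even after
    two cancellations.\<close>
  have primitive: "a \<in> val_ge val 1 \<and> b \<in> val_ge val 1 \<and> c \<in> val_ge val 1"
    if abc: "a \<in> val_ring val" "b \<in> val_ring val" "c \<in> val_ring val"
      and rel: "\<iota> a + \<pi> * (\<iota> b + \<pi> * \<iota> c) = 0" for a b c
  proof -
    note int = abc[THEN \<iota>_val_ring_integral] \<pi>_integral
    have neg: "x = \<pi> * - y" if "x + \<pi> * y = 0" for x y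
      using that by (simp only: mult_minus_right eq_neg_iff_add_eq_0)
    have "\<iota> a = \<pi> * - (\<iota> b + \<pi> * \<iota> c)"
      using rel by (rule neg)
    moreover have "- (\<iota> b + \<pi> * \<iota> c) \<in> O_L"
      using int by (intro O_L_uminus O_L_add O_L_mult)
    ultimately have a: "a \<in> val_ge val 1"
      using div1[OF abc(1)] by blast
    then obtain z where z: "z \<in> O_L" "\<iota> a = \<pi> * (\<pi> * (\<pi> * z))"
      using div3 by blast
    have "\<pi> * (\<pi> * (\<pi> * z) + (\<iota> b + \<pi> * \<iota> c)) = \<pi> * 0"
      using rel unfolding z(2) by (simp add: algebra_simps)
    then have rel2: "\<pi> * (\<pi> * z) + (\<iota> b + \<pi> * \<iota> c) = 0"
      by (rule \<pi>_cancel)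
    then have "\<iota> b = \<pi> * - (\<pi> * z + \<iota> c)"
      by (intro neg) (simp add: algebra_simps)
    moreover have "- (\<pi> * z + \<iota> c) \<in> O_L"
      using int z by (intro O_L_uminus O_L_add O_L_mult)
    ultimately have b: "b \<in> val_ge val 1"
      using div1[OF abc(2)] by blast
    then obtain y where y: "y \<in> O_L" "\<iota> b = \<pi> * (\<pi> * (\<pi> * y))"
      using div3 by blast
    have "\<pi> * (\<pi> * z + \<pi> * (\<pi> * y) + \<iota> c) = \<pi> * 0"
      using rel2 unfolding y(2) by (simp add: algebra_simps)
    then have "\<pi> * z + \<pi> * (\<pi> * y) + \<iota> c = 0"
      by (rule \<pi>_cancel)
    then have "\<iota> c = \<pi> * - (z + \<pi> * y)"
      by (intro neg) (simp add: algebra_simps)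
    moreover have "- (z + \<pi> * y) \<in> O_L"
      using int z y by (intro O_L_uminus O_L_add O_L_mult)
    ultimately have "c \<in> val_ge val 1"
      using div1[OF abc(3)] by blast
    then show ?thesis
      using a b by blast
  qed
  \<comment> \<open>A nontrivial relation among 1, \<open>\<pi>\<close> and its square exists
    because L has dimension 2.\<close>
  obtain a b c where abc: "\<iota> a + \<pi> * (\<iota> b + \<pi> * \<iota> c) = 0" "b \<noteq> 0 \<or> c \<noteq> 0"
  proof (cases "\<pi> \<in> range \<iota>")
    case True
    then obtain a where "\<pi> = \<iota> a"
      by auto
    then show ?thesis
      using that[of "- a" 1 0] by (simp add: \<iota>_hom)
  next
    case False
    then obtain r s where "\<pi> * \<pi> = \<iota> r * 1 + \<iota> s * \<pi>"
      using independent_pair_imp_span[of 1 \<pi> "\<pi> * \<pi>"] one_independent[OF False] by auto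
    then show ?thesis
      using that[of "- r" "- s" 1] by (simp add: \<iota>_hom algebra_simps)
  qed
  \<comment> \<open>Dividing by the coefficient \<open>l\<close> of least valuation keeps all
    coefficients integral and turns one of them into 1, which \<open>primitive\<close>
    forbids.\<close>
  define A where "A = {a, b, c} - {0}"
  have "finite A" "A \<noteq> {}"
    using abc(2) by (auto simp: A_def)
  then obtain l where l: "l \<in> A" "\<And>x. x \<in> A \<Longrightarrow> val l \<le> val x"
    using ex_is_arg_min_if_finite[of A val] by (auto simp: is_arg_min_linorder)
  then have "l \<noteq> 0"
    by (auto simp: A_def)
  have int: "inverse l * x \<in> val_ring val" if "x \<in> {a, b, c}" for x
    using l(2)[of x] \<open>l \<noteq> 0\<close> that
    by (cases "x = 0") (auto simp: A_def val_ge_def val_mult val_inverse)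
  have "\<iota> (inverse l * a) + \<pi> * (\<iota> (inverse l * b) + \<pi> * \<iota> (inverse l * c)) =
      \<iota> (inverse l) * (\<iota> a + \<pi> * (\<iota> b + \<pi> * \<iota> c))"
    by (simp add: \<iota>_mult algebra_simps)
  then have "\<forall>x\<in>{a, b, c}. inverse l * x \<in> val_ge val 1"
    using primitive[of "inverse l * a" "inverse l * b" "inverse l * c"] int abc(1) by simp
  then have "inverse l * l \<in> val_ge val 1"
    using l(1) by (auto simp: A_def)
  then show False
    using \<open>l \<noteq> 0\<close> by (simp add: val_ge_def val_one)
qed

end

lemma basin_eq_level_0:
  assumes "is_basin val p \<iota> P"
  shows "P = level_le 0"
proof -
  consider (unramified) "unramified_ext val p \<iota>" "P = {homothety_class \<iota> O_L}"
    | (ramified) \<pi> where "ramified_ext val p \<iota>" "uniformizer_L val \<iota> \<pi>"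
      "P = {homothety_class \<iota> O_L, homothety_class \<iota> ((\<lambda>x. \<pi> * x) ` O_L)}"
    | (split) \<phi> where "splitting_iso \<iota> \<phi>"
      "P = {homothety_class \<iota> (\<phi> -` (val_ring val \<times> (\<lambda>x. p powi m * x) ` val_ring val)) |m. True}"
    using assms unfolding is_basin_def by blast
  then show ?thesis
  proof cases
    case unramified
    then obtain \<pi> where \<pi>: "uniformizer_L val \<iota> \<pi>"
        "(\<lambda>x. \<iota> p * x) ` O_L = (\<lambda>x. \<pi> ^ 1 * x) ` O_L"
      unfolding unramified_ext_def has_ramification_index_def by blast
    show ?thesis
      using field_level_0_eq[OF \<pi>] unramified(2) by simp
  next
    case ramified
    then obtain \<pi>' e where \<pi>': "uniformizer_L val \<iota> \<pi>'"
        "(\<lambda>x. \<iota> p * x) ` O_L = (\<lambda>x. \<pi>' ^ e * x) ` O_L" "e > 0" "e > 1"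
      unfolding ramified_ext_def has_ramification_index_def by auto
    then have "e = 2"
      using ramification_index_le_2[OF \<pi>'(1-3)] by simp
    then have "level_le 0 = {homothety_class \<iota> ((\<lambda>y. \<pi>' ^ r * y) ` O_L) |r. r = 0 \<or> r = 1}"
      using field_level_0_eq[OF \<pi>'(1-3)] by (simp add: less_2_cases_iff)
    also have "\<dots> = {homothety_class \<iota> O_L, homothety_class \<iota> ((\<lambda>y. \<pi>' * y) ` O_L)}"
      by (auto intro: exI[of _ 0] exI[of _ 1])
    \<comment> \<open>The uniformizer of the basin and the one witnessing the ramification index may
      differ; both generate the ideal of nonunits.\<close>
    also have "(\<lambda>y. \<pi>' * y) ` O_L = (\<lambda>y. \<pi> * y) ` O_L"
      using \<pi>'(1) ramified(2) unfolding uniformizer_L_def by simp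
    finally show ?thesis
      using ramified(3) by simp
  next
    case split
    then show ?thesis
      using split_basin by simp
  qed
qed

end

theorem theorem5p32:
  fixes val :: "'k::field_char_0 \<Rightarrow> int" and p :: 'k
    and \<iota> :: "'k \<Rightarrow> 'l::comm_ring_1" and \<Delta> :: 'l
    and P :: "'l set set set" and n :: nat and v :: "'l set set"
  assumes "quadratic_algebra val p \<iota> \<Delta>"
    and "is_basin val p \<iota> P"
    and "v \<in> tree_vertices val \<iota>"
  shows "(\<exists>I. principal_ideal_of (quadratic_order val p \<iota> \<Delta> n) I \<and> free_rank_2 val \<iota> I \<and>
            v = homothety_class \<iota> I)
         \<longleftrightarrow> v \<in> layer val p \<iota> P n"
proof -
  interpret quadratic_algebra val p \<iota> \<Delta>
    by fact
  have "v \<in> layer val p \<iota> P n \<longleftrightarrow> v \<in> level_le n \<and> (n = 0 \<or> v \<notin> level_le (n - 1))"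
    using basin_nbhd_eq_level_le unfolding basin_eq_level_0[OF assms(2)]
    by (cases n) (simp_all del: basin_nbhd.simps)
  then show ?thesis
    using principal_class_iff[OF assms(3)] by simp
qed

end
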